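(* Let $\{w(f)\}$ be i.i.d. random variables indexed by the edges $f$ of the infinite bipartite graph $K_{tot}$, with $w(f)\ge0$ almost surely, with continuous distribution, and with $\mathbb{E}w^2(f)<\infty$. Let $\mu=\mathbb{E}w(f)$. For $0\le\rho\le1$ let $M_n(\rho n)$ be the minimum weight of a planar matching of $K_{n,n}$ containing at least $\rho n$ edges. Then for every $0\le\rho\le1$ there exists a constant $\theta(\rho)$ such that $$\frac{M_n(\rho n)}{n}\longrightarrow\theta(\rho)\quad\text{in probability and in }L^2\text{ as }n\to\infty.$$ Moreover: (a) The function $\theta(\rho)$ is non-decreasing and convex for $\rho\in[0,1]$, and satisfies $\theta(0)=0$ and $0<\theta(\rho)<\mu\rho$ (strict inequalities) for $0<\rho<1$. (b) If $\mathbb{E}w^4(f)<\infty$, then (for every $0\le\rho\le1$) $\frac{M_n(\rho n)}{n}\longrightarrow\theta(\rho)$ almost surely as $n\to\infty$.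
   Context: $K_{tot}$ is the infinite bipartite graph with top vertices $u_1,u_2,\dots$, bottom vertices $v_1,v_2,\dots$ and all edges $(u_i,v_j)$, $i,j\ge1$. For an integer $n\ge1$, $K_{n,n}\subset K_{tot}$ is the complete bipartite graph on top vertices $u_1,\dots,u_n$ and bottom vertices $v_1,\dots,v_n$; the weights on $K_{n,n}$ are the restrictions of the single family $\{w(f)\}$. A planar matching of $K_{n,n}$ is a set of edges $\{(u_{i_1},v_{j_1}),\dots,(u_{i_t},v_{j_t})\}$ that can be indexed so that $i_1<i_2<\dots<i_t$ and $j_1<j_2<\dots<j_t$; its size is $t$. The empty set is a planar matching of size $0$ and weight $0$. The weight of a planar matching $\mathcal{P}$ is $\sum_{f\in\mathcal{P}}w(f)$. *)

theory Defs
  imports "HOL-Probability.Probability"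
begin

text \<open>The edge joining the top vertex \<open>u\<^sub>i\<close> to the bottom vertex \<open>v\<^sub>j\<close> is
  represented by the pair \<open>(i, j)\<close>, with indices starting at 1.\<close>

definition K_tot :: "(nat \<times> nat) set" where
  "K_tot = {1..} \<times> {1..}"

definition K_bip :: "nat \<Rightarrow> (nat \<times> nat) set" where
  "K_bip n = {1..n} \<times> {1..n}"

definition planar_matching :: "nat \<Rightarrow> (nat \<times> nat) set \<Rightarrow> bool" where
  "planar_matching n P \<longleftrightarrow> P \<subseteq> K_bip n \<and>
     (\<exists>(t::nat) i j. strict_mono_on {1..t} i \<and> strict_mono_on {1..t} j \<and>
        P = (\<lambda>k. (i k, j k)) ` {1..t})"

text \<open>\<open>min_weight w n r\<close> is the random variable \<open>M\<^sub>n(r)\<close>. The minimum ranges over a finite set,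
  which is nonempty for \<open>r \<le> n\<close> because of the diagonal matching.\<close>

definition min_weight :: "(nat \<times> nat \<Rightarrow> 'a \<Rightarrow> real) \<Rightarrow> nat \<Rightarrow> real \<Rightarrow> 'a \<Rightarrow> real" where
  "min_weight w n r \<omega> =
     Min ((\<lambda>P. \<Sum>f\<in>P. w f \<omega>) ` {P. planar_matching n P \<and> r \<le> real (card P)})"

definition iid_family :: "'a measure \<Rightarrow> 'i set \<Rightarrow> ('i \<Rightarrow> 'a \<Rightarrow> real) \<Rightarrow> bool" where
  "iid_family M I X \<longleftrightarrow> prob_space.indep_vars M (\<lambda>_. borel) X I \<and>
     (\<forall>f\<in>I. \<forall>g\<in>I. distr M borel (X f) = distr M borel (X g))"

text \<open>A continuous distribution is one with continuous distribution function; a density is not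
  required.\<close>

definition continuous_distribution :: "'a measure \<Rightarrow> ('a \<Rightarrow> real) \<Rightarrow> bool" where
  "continuous_distribution M X \<longleftrightarrow> continuous_on UNIV (cdf (distr M borel X))"

definition converges_in_probability ::
  "'a measure \<Rightarrow> (nat \<Rightarrow> 'a \<Rightarrow> real) \<Rightarrow> real \<Rightarrow> bool" where
  "converges_in_probability M X c \<longleftrightarrow> (\<forall>n. X n \<in> borel_measurable M) \<and>
     (\<forall>\<epsilon>>0. (\<lambda>n. measure M {\<omega> \<in> space M. \<bar>X n \<omega> - c\<bar> > \<epsilon>}) \<longlonglongrightarrow> 0)"

text \<open>The second moment is taken in the extended sense, because the Bochner integral of a
  non-integrable function is 0 by convention.\<close>

definition converges_in_L2 ::
  "'a measure \<Rightarrow> (nat \<Rightarrow> 'a \<Rightarrow> real) \<Rightarrow> real \<Rightarrow> bool" where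
  "converges_in_L2 M X c \<longleftrightarrow> (\<forall>n. X n \<in> borel_measurable M) \<and>
     (\<lambda>n. \<integral>\<^sup>+\<omega>. ennreal ((X n \<omega> - c)\<^sup>2) \<partial>M) \<longlonglongrightarrow> 0"

end

theory Submission
  imports Defs "HOL-Library.Discrete_Functions"
begin

text \<open>
  Placing planar matchings of consecutive diagonal blocks side by side shows that the minimum weights
  \<open>a m n\<close> of the blocks \<open>{m+1..m+n} \<times> {m+1..m+n}\<close> form a nonnegative stationary subadditive process, and
  disjoint blocks of equal length are independent. The limit \<open>\<theta>\<close> of the normalised means exists by Fekete's lemma.
  Comparing \<open>a 0 n\<close> with a sum of independent blocks bounds the second moment of its excess over
  \<open>(\<theta> + \<epsilon>) n\<close>; since the mean is at least \<open>\<theta> n\<close>, the deficit below \<open>\<theta> n\<close> is then small on average, and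
  being bounded by \<open>\<theta> n\<close> it is small in \<open>L\<^sup>2\<close>. Almost sure convergence follows by Steele's argument
  for Kingman's subadditive ergodic theorem.

  Convexity comes from concatenating matchings of different densities. Positivity of \<open>\<theta> \<rho>\<close> comes from
  the Laplace transform \<open>\<phi>\<close> of a weight: there are at most \<open>4 ^ n\<close> planar matchings, each contributing at
  most \<open>\<phi> s powr (\<rho> n)\<close>, and \<open>\<phi> s\<close> tends to \<open>0\<close> as \<open>s\<close> grows. The strict upper bound at \<open>\<rho> = 1/2\<close>
  comes from choosing the lighter of two edges, and spreads to \<open>(0, 1)\<close> by convexity.
\<close>

section \<open>Stationary subadditive processes with independent blocks\<close>

text \<open>Division with remainder by a fixed \<open>N\<close> gives
  \<open>x n \<le> (n div N) * x N + N * x 1\<close>. After division by \<open>n\<close>, the upper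
  limit is at most \<open>x N / N\<close> for every \<open>N\<close>. Nonnegativity bounds the
  ratios below, so the infimum is a genuine one.\<close>

lemma fekete:
  fixes x :: "nat \<Rightarrow> real"
  assumes nonneg: "\<And>n. 0 \<le> x n" and subadd: "\<And>m n. x (m + n) \<le> x m + x n" and "x 0 = 0"
  shows "(\<lambda>n. x n / n) \<longlonglongrightarrow> (INF n\<in>{1..}. x n / real n)"
proof -
  define c where "c = (INF n\<in>{1..}. x n / real n)"
  have bdd: "bdd_below ((\<lambda>n. x n / real n) ` {1..})"
    using nonneg by (intro bdd_belowI[of _ 0]) auto
  have mult: "x (q * N) \<le> q * x N" for q N
  proof (induction q)
    case (Suc q)
    then show ?case using subadd[of N "q * N"] by (simp add: algebra_simps)
  qed (simp add: \<open>x 0 = 0\<close>)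
  have lower: "c \<le> x n / n" if "n \<ge> 1" for n
    unfolding c_def using that by (intro cINF_lower bdd) auto
  have upper: "\<forall>\<^sub>F n in sequentially. x n / n < c + \<epsilon>" if "\<epsilon> > 0" for \<epsilon>
  proof -
    have "\<exists>N\<in>{1..}. x N / real N < c + \<epsilon>/2"
      using cINF_less_iff[OF _ bdd, of "c + \<epsilon>/2"] that unfolding c_def by auto
    then obtain N where N: "N \<ge> 1" "x N / real N < c + \<epsilon>/2" by auto
    have bound: "x n / n \<le> x N / N + N * x 1 / n" if "n \<ge> 1" for n
    proof -
      have "x n \<le> x (n div N * N) + x (n mod N)"
        using subadd[of "n div N * N" "n mod N"] by simp
      also have "x (n div N * N) \<le> (n div N) * x N" by (rule mult)
      also have "x (n mod N) \<le> (n mod N) * x 1" using mult[of "n mod N" 1] by simp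
      also have "(n mod N) * x 1 \<le> N * x 1"
        using nonneg[of 1] N by (intro mult_right_mono) (auto simp: less_imp_le)
      finally have 1: "x n \<le> real (n div N) * x N + N * x 1" by simp
      have "real (n div N) \<le> real n / real N"
        using N div_times_less_eq_dividend[of n N]
        by (simp add: field_simps flip: of_nat_mult of_nat_le_iff)
      then have "real (n div N) * x N \<le> real n / real N * x N"
        using nonneg by (rule mult_right_mono)
      with 1 have "x n \<le> n * (x N / N) + N * x 1" by simp
      then show ?thesis using that by (simp add: field_simps)
    qed
    have "(\<lambda>n. N * x 1 / real n) \<longlonglongrightarrow> 0"
      by (rule lim_const_over_n)
    then have "\<forall>\<^sub>F n in sequentially. N * x 1 / real n < \<epsilon>/2"
      using that by (intro order_tendstoD(2)) auto
    then show ?thesis using eventually_ge_at_top[of 1]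
    proof eventually_elim
      case (elim n)
      then show ?case using bound[of n] N(2) by linarith
    qed
  qed
  have "(\<lambda>n. x n / n) \<longlonglongrightarrow> c"
  proof (rule order_tendstoI)
    fix y assume "y < c"
    show "\<forall>\<^sub>F n in sequentially. y < x n / n"
      using eventually_ge_at_top[of 1] by eventually_elim (use lower \<open>y < c\<close> in fastforce)
  next
    fix y assume "c < y"
    then show "\<forall>\<^sub>F n in sequentially. x n / n < y"
      using upper[of "y - c"] by simp
  qed
  then show ?thesis by (simp add: c_def)
qed

text \<open>Stands in for a Borel-Cantelli argument: the sum of all \<open>f k\<close> has finite
  integral, hence is finite almost surely, and the terms of a convergent series vanish.\<close>

lemma AE_tendsto_zero_if_summable_integral:
  fixes f :: "nat \<Rightarrow> 'a \<Rightarrow> real"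
  assumes int: "\<And>k. integrable M (f k)" and nonneg: "\<And>k \<omega>. 0 \<le> f k \<omega>"
    and bound: "\<And>k. (\<integral>\<omega>. f k \<omega> \<partial>M) \<le> b k" and "summable b"
  shows "AE \<omega> in M. (\<lambda>k. f k \<omega>) \<longlonglongrightarrow> 0"
proof -
  have [measurable]: "\<And>k. f k \<in> borel_measurable M" using int by auto
  have sm: "summable (\<lambda>k. \<integral>\<omega>. f k \<omega> \<partial>M)"
    by (rule summable_comparison_test'[OF \<open>summable b\<close>, of 0])
       (use bound nonneg in \<open>simp add: integral_nonneg_AE\<close>)
  have "(\<integral>\<^sup>+\<omega>. (\<Sum>k. ennreal (f k \<omega>)) \<partial>M) = (\<Sum>k. \<integral>\<^sup>+\<omega>. ennreal (f k \<omega>) \<partial>M)"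
    by (rule nn_integral_suminf) simp
  also have "\<dots> = (\<Sum>k. ennreal (\<integral>\<omega>. f k \<omega> \<partial>M))"
    using int nonneg by (intro arg_cong[where f = suminf] ext nn_integral_eq_integral) auto
  also have "\<dots> = ennreal (\<Sum>k. \<integral>\<omega>. f k \<omega> \<partial>M)"
    using nonneg by (intro suminf_ennreal2 sm) (simp add: integral_nonneg_AE)
  finally have "AE \<omega> in M. (\<Sum>k. ennreal (f k \<omega>)) \<noteq> \<infinity>"
    by (intro nn_integral_PInf_AE) auto
  then show ?thesis
  proof eventually_elim
    case (elim \<omega>)
    have "summable (\<lambda>k. f k \<omega>)"
      by (rule summable_suminf_not_top) (use nonneg elim in auto)
    then show ?case by (rule summable_LIMSEQ_zero)
  qed
qed

text \<open>The greedy partition of Steele's proof of Kingman's theorem: at \<open>i\<close>, jump over a block of length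
  at most \<open>K\<close> with average at most \<open>y\<close> if there is one, and otherwise pay \<open>b i 1\<close> for a single step.
  The last sum pays for single steps near the right end, where a block might not fit.\<close>
lemma greedy_bound:
  fixes b :: "nat \<Rightarrow> nat \<Rightarrow> real"
  assumes nonneg: "\<And>m n. 0 \<le> b m n" and zero: "\<And>m. b m 0 = 0"
    and subadd: "\<And>m n k. b m (n + k) \<le> b m n + b (m + n) k"
    and single: "\<And>m n. b m n \<le> (\<Sum>i<n. b (m + i) 1)" and "y \<ge> 0"
  shows "b m n \<le> y * n + (\<Sum>i\<in>{m..<m + n}. if \<forall>l\<in>{1..K}. b i l > y * l then b i 1 else 0)
                  + (\<Sum>i\<in>{m + n - K..<m + n}. b i 1)"
proof (induction n arbitrary: m rule: less_induct)
  case (less n)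
  let ?bad = "\<lambda>i. if \<forall>l\<in>{1..K}. b i l > y * l then b i 1 else 0"
  have bad_nonneg: "?bad i \<ge> 0" for i using nonneg by simp
  show ?case
  \<comment> \<open>If \<open>n \<le> K\<close>, then \<open>m + n - K \<le> m\<close>, and the last
    sum already pays for every single step.\<close>
  proof (cases "n \<le> K")
    case True
    have "b m n \<le> (\<Sum>i\<in>{m..<m + n}. b i 1)"
      using single[of m n] sum.shift_bounds_nat_ivl[of "\<lambda>i. b i 1" 0 m n]
      by (simp add: add.commute lessThan_atLeast0)
    also have "\<dots> \<le> (\<Sum>i\<in>{m + n - K..<m + n}. b i 1)"
      using True nonneg by (intro sum_mono2) auto
    finally show ?thesis
      using \<open>y \<ge> 0\<close> sum_nonneg[of "{m..<m + n}" ?bad, OF bad_nonneg] mult_nonneg_nonneg[OF \<open>y \<ge> 0\<close>, of "real n"]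
      by linarith
  next
    case False
    show ?thesis
    \<comment> \<open>Now \<open>n > K\<close>, so a jump of length at most \<open>K\<close> stays
      inside the interval. Both recursive calls keep the right end \<open>m + n\<close>, so the last
      sum passes through unchanged.\<close>
    proof (cases "\<forall>l\<in>{1..K}. b m l > y * l")
      case True
      have n: "n = 1 + (n - 1)" using False by simp
      have "b m n \<le> b m 1 + b (m + 1) (n - 1)" using subadd[of m 1 "n - 1"] n by simp
      also have "\<dots> \<le> b m 1 + (y * real (n - 1) + (\<Sum>i\<in>{m + 1..<m + n}. ?bad i) + (\<Sum>i\<in>{m + n - K..<m + n}. b i 1))"
        using less.IH[of "n - 1" "m + 1"] False by simp
      also have "b m 1 = ?bad m" using True by simp
      also have "(\<Sum>i\<in>{m + 1..<m + n}. ?bad i) = (\<Sum>i\<in>{m..<m + n}. ?bad i) - ?bad m"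
        using sum.atLeast_Suc_lessThan[of m "m + n" ?bad] False by simp
      finally show ?thesis using \<open>y \<ge> 0\<close> mult_left_mono[of "real (n - 1)" "real n" y] by linarith
    next
      case notbad: False
      then obtain l where l: "l \<in> {1..K}" "b m l \<le> y * l" by force
      have n: "n = l + (n - l)" using False l by simp
      have "b m n \<le> b m l + b (m + l) (n - l)" using subadd[of m l "n - l"] n by simp
      also have "\<dots> \<le> y * l + (y * real (n - l) + (\<Sum>i\<in>{m + l..<m + n}. ?bad i) + (\<Sum>i\<in>{m + n - K..<m + n}. b i 1))"
        using less.IH[of "n - l" "m + l"] False l by (intro add_mono) simp_all
      also have "(\<Sum>i\<in>{m + l..<m + n}. ?bad i) \<le> (\<Sum>i\<in>{m..<m + n}. ?bad i)"
        by (intro sum_mono2) (use bad_nonneg in auto)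
      finally show ?thesis using n by (simp add: of_nat_diff algebra_simps)
    qed
  qed
qed

text \<open>Stationarity concerns the joint law of a whole row \<open>a m\<close>, because the lower
  limit of a row is among the functionals that get shifted. Independence of consecutive blocks of
  one length feeds the variance estimate.\<close>

locale subadditive_process = prob_space +
  fixes a :: "nat \<Rightarrow> nat \<Rightarrow> 'a \<Rightarrow> real"
  assumes measurable_a [measurable]: "\<And>m n. a m n \<in> borel_measurable M"
    and nonneg: "\<And>m n \<omega>. 0 \<le> a m n \<omega>"
    and zero: "\<And>m \<omega>. a m 0 \<omega> = 0"
    and subadd: "\<And>m n k \<omega>. a m (n + k) \<omega> \<le> a m n \<omega> + a (m + n) k \<omega>"
    and stationary: "\<And>m. distr M (PiM UNIV (\<lambda>_. borel)) (\<lambda>\<omega> n. a m n \<omega>)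
                        = distr M (PiM UNIV (\<lambda>_. borel)) (\<lambda>\<omega> n. a 0 n \<omega>)"
    and indep_blocks: "\<And>N. indep_vars (\<lambda>_. borel) (\<lambda>i. a (i * N) N) UNIV"
    and square_integrable_1: "integrable M (\<lambda>\<omega>. (a 0 1 \<omega>)\<^sup>2)"
begin

lemma measurable_row [measurable]: "(\<lambda>\<omega> n. a m n \<omega>) \<in> measurable M (PiM UNIV (\<lambda>_. borel))"
  by (rule measurable_PiM_single') auto

lemma integrable_shift:
  fixes g :: "(nat \<Rightarrow> real) \<Rightarrow> real"
  assumes [measurable]: "g \<in> borel_measurable (PiM UNIV (\<lambda>_. borel))"
  shows "integrable M (\<lambda>\<omega>. g (\<lambda>n. a m n \<omega>)) \<longleftrightarrow> integrable M (\<lambda>\<omega>. g (\<lambda>n. a 0 n \<omega>))"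
  using integrable_distr_eq[OF measurable_row[of m] assms] integrable_distr_eq[OF measurable_row[of 0] assms]
  by (simp add: stationary[of m])

lemma integral_shift:
  fixes g :: "(nat \<Rightarrow> real) \<Rightarrow> real"
  assumes [measurable]: "g \<in> borel_measurable (PiM UNIV (\<lambda>_. borel))"
  shows "(\<integral>\<omega>. g (\<lambda>n. a m n \<omega>) \<partial>M) = (\<integral>\<omega>. g (\<lambda>n. a 0 n \<omega>) \<partial>M)"
  using integral_distr[OF measurable_row[of m] assms] integral_distr[OF measurable_row[of 0] assms]
  by (simp add: stationary[of m])

lemma AE_shift:
  fixes P :: "(nat \<Rightarrow> real) \<Rightarrow> bool"
  assumes "Measurable.pred (PiM UNIV (\<lambda>_. borel)) P"
  shows "(AE \<omega> in M. P (\<lambda>n. a m n \<omega>)) \<longleftrightarrow> (AE \<omega> in M. P (\<lambda>n. a 0 n \<omega>))"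
proof -
  have P: "{x \<in> space (PiM UNIV (\<lambda>_. borel)). P x} \<in> sets (PiM UNIV (\<lambda>_. borel))"
    using assms by (simp add: pred_def)
  show ?thesis
    using AE_distr_iff[OF measurable_row[of m] P] AE_distr_iff[OF measurable_row[of 0] P]
    unfolding stationary[of m] by blast
qed

section \<open>Moment bounds and the limit of the means\<close>

lemma a_le_sum: "a m n \<omega> \<le> (\<Sum>i<n. a (m + i) 1 \<omega>)"
proof (induction n)
  case (Suc n)
  then show ?case using subadd[of m n 1 \<omega>] by simp
qed (simp add: zero)

lemma square_integrable_single: "integrable M (\<lambda>\<omega>. (a m 1 \<omega>)\<^sup>2)"
  using integrable_shift[of "\<lambda>x. (x 1)\<^sup>2" m] square_integrable_1 by simp

definition "second_moment = (\<integral>\<omega>. (a 0 1 \<omega>)\<^sup>2 \<partial>M)"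

lemma second_moment_single: "(\<integral>\<omega>. (a m 1 \<omega>)\<^sup>2 \<partial>M) = second_moment"
  using integral_shift[of "\<lambda>x. (x 1)\<^sup>2" m] by (simp add: second_moment_def)

lemma second_moment_nonneg: "0 \<le> second_moment"
  by (simp add: second_moment_def)

text \<open>Cauchy-Schwarz. Growth quadratic in \<open>n\<close> is affordable: the bound is used
  for blocks of bounded length and for the gaps between consecutive squares, which are short
  compared with the squares.\<close>

lemma square_sum_singles:
  shows "integrable M (\<lambda>\<omega>. (\<Sum>i<n. a (m + i) 1 \<omega>)\<^sup>2)"
    and "(\<integral>\<omega>. (\<Sum>i<n. a (m + i) 1 \<omega>)\<^sup>2 \<partial>M) \<le> (real n)\<^sup>2 * second_moment"
proof -
  have pt: "(\<Sum>i<n. a (m + i) 1 \<omega>)\<^sup>2 \<le> n * (\<Sum>i<n. (a (m + i) 1 \<omega>)\<^sup>2)" for \<omega>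
    using sum_squared_le_sum_of_squares[of "\<lambda>i. a (m + i) 1 \<omega>" "{..<n}"] by (simp add: mult.commute)
  have int: "integrable M (\<lambda>\<omega>. n * (\<Sum>i<n. (a (m + i) 1 \<omega>)\<^sup>2))"
    using square_integrable_single by auto
  show *: "integrable M (\<lambda>\<omega>. (\<Sum>i<n. a (m + i) 1 \<omega>)\<^sup>2)"
    by (rule Bochner_Integration.integrable_bound[OF int]) (use pt in \<open>auto simp: sum_nonneg\<close>)
  have "(\<integral>\<omega>. (\<Sum>i<n. a (m + i) 1 \<omega>)\<^sup>2 \<partial>M) \<le> (\<integral>\<omega>. n * (\<Sum>i<n. (a (m + i) 1 \<omega>)\<^sup>2) \<partial>M)"
    by (rule integral_mono[OF * int pt])
  also have "\<dots> = (real n)\<^sup>2 * second_moment"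
    using square_integrable_single second_moment_single by (simp add: power2_eq_square Bochner_Integration.integral_sum)
  finally show "(\<integral>\<omega>. (\<Sum>i<n. a (m + i) 1 \<omega>)\<^sup>2 \<partial>M) \<le> (real n)\<^sup>2 * second_moment" .
qed

lemma square_integrable_a: "integrable M (\<lambda>\<omega>. (a m n \<omega>)\<^sup>2)"
  and square_integral_a_le: "(\<integral>\<omega>. (a m n \<omega>)\<^sup>2 \<partial>M) \<le> (real n)\<^sup>2 * second_moment"
proof -
  have pt: "(a m n \<omega>)\<^sup>2 \<le> (\<Sum>i<n. a (m + i) 1 \<omega>)\<^sup>2" for \<omega>
    by (intro power_mono a_le_sum nonneg)
  show *: "integrable M (\<lambda>\<omega>. (a m n \<omega>)\<^sup>2)"
    by (rule Bochner_Integration.integrable_bound[OF square_sum_singles(1)]) (use pt in auto)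
  show "(\<integral>\<omega>. (a m n \<omega>)\<^sup>2 \<partial>M) \<le> (real n)\<^sup>2 * second_moment"
    using integral_mono[OF * square_sum_singles(1) pt] square_sum_singles(2)[where m = m and n = n] by linarith
qed

lemma integrable_a [simp]: "integrable M (a m n)"
  by (rule square_integrable_imp_integrable[OF _ square_integrable_a]) simp

definition "mean n = (\<integral>\<omega>. a 0 n \<omega> \<partial>M)"

lemma integral_a: "(\<integral>\<omega>. a m n \<omega> \<partial>M) = mean n"
  using integral_shift[of "\<lambda>x. x n" m] by (simp add: mean_def)

lemma mean_nonneg: "0 \<le> mean n"
  by (simp add: mean_def nonneg)

lemma mean_zero: "mean 0 = 0"
  by (simp add: mean_def zero)

lemma mean_subadd: "mean (m + n) \<le> mean m + mean n"
proof -
  have "mean (m + n) \<le> (\<integral>\<omega>. a 0 m \<omega> + a m n \<omega> \<partial>M)"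
    unfolding mean_def using subadd[of 0 m n] by (intro integral_mono) auto
  then show ?thesis by (simp add: integral_a)
qed

definition "\<theta> = (INF n\<in>{1..}. mean n / real n)"

lemma mean_tendsto: "(\<lambda>n. mean n / n) \<longlonglongrightarrow> \<theta>"
  unfolding \<theta>_def by (intro fekete mean_nonneg mean_subadd mean_zero)

lemma \<theta>_le: "n \<ge> 1 \<Longrightarrow> \<theta> \<le> mean n / n"
  unfolding \<theta>_def by (intro cINF_lower bdd_belowI[of _ 0]) (use mean_nonneg in auto)

lemma \<theta>_nonneg: "0 \<le> \<theta>"
  unfolding \<theta>_def by (intro cINF_greatest) (use mean_nonneg in auto)

section \<open>Variance of block sums and deviations above the limit\<close>

text \<open>Independence makes the centred blocks orthogonal, so the second moment of their sum
  grows only linearly in the number \<open>k\<close> of blocks.\<close>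

lemma block_sum_variance:
  fixes N k :: nat
  defines "X \<equiv> \<lambda>(i::nat) \<omega>. a (i * N) N \<omega> - mean N"
  shows "integrable M (\<lambda>\<omega>. (\<Sum>i<k. X i \<omega>)\<^sup>2)"
    and "(\<integral>\<omega>. (\<Sum>i<k. X i \<omega>)\<^sup>2 \<partial>M) \<le> k * ((real N)\<^sup>2 * second_moment)"
proof -
  have sqX: "integrable M (\<lambda>\<omega>. X i \<omega> * X i \<omega>)" for i
  proof -
    have "(\<lambda>\<omega>. X i \<omega> * X i \<omega>) = (\<lambda>\<omega>. (a (i * N) N \<omega>)\<^sup>2 - 2 * mean N * a (i * N) N \<omega> + (mean N)\<^sup>2)"
      by (auto simp: X_def power2_eq_square algebra_simps)
    then show ?thesis using square_integrable_a by simp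
  qed
  have diag: "(\<integral>\<omega>. X i \<omega> * X i \<omega> \<partial>M) \<le> (real N)\<^sup>2 * second_moment" for i
  proof -
    have "(\<lambda>\<omega>. X i \<omega> * X i \<omega>) = (\<lambda>\<omega>. (a (i * N) N \<omega>)\<^sup>2 - 2 * mean N * a (i * N) N \<omega> + (mean N)\<^sup>2)"
      by (auto simp: X_def power2_eq_square algebra_simps)
    then have "(\<integral>\<omega>. X i \<omega> * X i \<omega> \<partial>M) = (\<integral>\<omega>. (a (i * N) N \<omega>)\<^sup>2 \<partial>M) - (mean N)\<^sup>2"
      using square_integrable_a by (simp add: integral_a prob_space) (simp add: power2_eq_square)
    also have "\<dots> \<le> (real N)\<^sup>2 * second_moment"
      using square_integral_a_le[of "i * N" N] by (smt (verit) zero_le_power2)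
    finally show ?thesis .
  qed
  have cross: "integrable M (\<lambda>\<omega>. X i \<omega> * X j \<omega>) \<and> (\<integral>\<omega>. X i \<omega> * X j \<omega> \<partial>M) = 0" if "i \<noteq> j" for i j
  proof -
    have "indep_vars (\<lambda>_. borel) X UNIV"
      unfolding X_def by (rule indep_vars_compose2[OF indep_blocks]) simp
    then have ind: "indep_vars (\<lambda>_. borel) X {i, j}"
      by (rule indep_vars_subset) simp
    have intX: "\<And>l. integrable M (X l)" by (simp add: X_def)
    have "(\<integral>\<omega>. X i \<omega> \<partial>M) = 0" by (simp add: X_def integral_a prob_space)
    then show ?thesis
      using indep_vars_integrable[OF _ ind] indep_vars_lebesgue_integral[OF _ ind] intX that by simp
  qed
  have int: "integrable M (\<lambda>\<omega>. X i \<omega> * X j \<omega>)" for i j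
    using sqX cross by (cases "i = j") auto
  have eq: "(\<Sum>i<k. X i \<omega>)\<^sup>2 = (\<Sum>i<k. \<Sum>j<k. X i \<omega> * X j \<omega>)" for \<omega>
    by (simp add: power2_eq_square sum_product)
  show "integrable M (\<lambda>\<omega>. (\<Sum>i<k. X i \<omega>)\<^sup>2)"
    unfolding eq using int by auto
  have "(\<integral>\<omega>. (\<Sum>i<k. X i \<omega>)\<^sup>2 \<partial>M) = (\<Sum>i<k. \<Sum>j<k. \<integral>\<omega>. X i \<omega> * X j \<omega> \<partial>M)"
    unfolding eq using int by (simp add: Bochner_Integration.integral_sum)
  also have "\<dots> = (\<Sum>i<k. \<Sum>j<k. if i = j then (\<integral>\<omega>. X i \<omega> * X i \<omega> \<partial>M) else 0)"
    using cross by (intro sum.cong) auto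
  also have "\<dots> = (\<Sum>i<k. (\<integral>\<omega>. X i \<omega> * X i \<omega> \<partial>M))"
    by (simp add: sum.delta)
  also have "\<dots> \<le> (\<Sum>i<k. (real N)\<^sup>2 * second_moment)"
    by (intro sum_mono) (use diag in auto)
  finally show "(\<integral>\<omega>. (\<Sum>i<k. X i \<omega>)\<^sup>2 \<partial>M) \<le> k * ((real N)\<^sup>2 * second_moment)" by simp
qed

lemma a_le_block_sum: "a 0 (k * N + r) \<omega> \<le> (\<Sum>i<k. a (i * N) N \<omega>) + a (k * N) r \<omega>"
proof -
  have "a 0 (k * N) \<omega> \<le> (\<Sum>i<k. a (i * N) N \<omega>)"
  proof (induction k)
    case (Suc k)
    then show ?case using subadd[of 0 "k * N" N \<omega>] by (simp add: add.commute)
  qed (simp add: zero)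
  then show ?thesis using subadd[of 0 "k * N" r \<omega>] by simp
qed

text \<open>One-sided, because subadditivity compares \<open>a 0 n\<close> with independent blocks
  only from above.\<close>

definition "excess c n \<omega> = (max 0 (a 0 n \<omega> / n - c))\<^sup>2"

lemma excess_measurable [measurable]: "excess c n \<in> borel_measurable M"
  unfolding excess_def by measurable

lemma integrable_excess: "c \<ge> 0 \<Longrightarrow> integrable M (excess c n)"
proof (rule Bochner_Integration.integrable_bound)
  show "integrable M (\<lambda>\<omega>. (a 0 n \<omega>)\<^sup>2 / (real n)\<^sup>2)" using square_integrable_a by simp
  assume "c \<ge> 0"
  have "(max 0 (a 0 n \<omega> / n - c))\<^sup>2 \<le> (a 0 n \<omega> / n)\<^sup>2" for \<omega>
    using nonneg[of 0 n \<omega>] \<open>c \<ge> 0\<close> by (intro power_mono) (auto simp: field_simps)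
  then show "AE \<omega> in M. norm (excess c n \<omega>) \<le> norm ((a 0 n \<omega>)\<^sup>2 / (real n)\<^sup>2)"
    by (auto simp: excess_def power_divide)
qed simp

text \<open>As \<open>\<theta>\<close> is an infimum, some block length \<open>N\<close> has
  \<open>mean N / N < c\<close>. With \<open>n = k * N + r\<close>, subadditivity bounds
  \<open>a 0 n - n * c\<close> by the centred sum of \<open>k\<close> blocks plus a remainder of
  length below \<open>N\<close>. Their second moments are linear in \<open>n\<close> and bounded,
  respectively, so division by \<open>n\<^sup>2\<close> leaves the order
  \<open>1 / n\<close>.\<close>

lemma excess_le:
  assumes "c > \<theta>"
  obtains C where "C \<ge> 0" "\<And>n. (\<integral>\<omega>. excess c n \<omega> \<partial>M) \<le> C / n"
proof -
  have bdd: "bdd_below ((\<lambda>n. mean n / real n) ` {1..})"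
    using mean_nonneg by (intro bdd_belowI[of _ 0]) auto
  have "\<exists>N\<in>{1..}. mean N / real N < c"
    using cINF_less_iff[OF _ bdd, of c] assms unfolding \<theta>_def by auto
  then obtain N where N: "N \<ge> 1" "mean N / real N < c" by auto
  have "c \<ge> 0" using \<theta>_nonneg assms by simp
  \<comment> \<open>The factor 4 arises from
    \<open>(s + t)\<^sup>2 \<le> 2 * s\<^sup>2 + 2 * t\<^sup>2\<close>, where both second moments
    are at most \<open>n * ((real N)\<^sup>2 * second_moment)\<close>.\<close>
  define C where "C = 4 * ((real N)\<^sup>2 * second_moment)"
  have "(\<integral>\<omega>. excess c n \<omega> \<partial>M) \<le> C / n" for n
  proof (cases "n = 0")
    \<comment> \<open>Division by zero gives 0 on the right, and on the left the positive part of
      \<open>- c\<close>, which is 0 as well.\<close>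
    case True
    then show ?thesis using \<open>c \<ge> 0\<close> by (simp add: excess_def)
  next
    case False
    define k where "k = n div N"
    define r where "r = n mod N"
    have n: "n = k * N + r" by (simp add: k_def r_def)
    define S where "S = (\<lambda>\<omega>. \<Sum>i<k. a (i * N) N \<omega> - mean N)"
    have intS: "integrable M (\<lambda>\<omega>. (S \<omega>)\<^sup>2)" and ES: "(\<integral>\<omega>. (S \<omega>)\<^sup>2 \<partial>M) \<le> k * ((real N)\<^sup>2 * second_moment)"
      unfolding S_def using block_sum_variance by auto
    have pt: "excess c n \<omega> \<le> (2 * (S \<omega>)\<^sup>2 + 2 * (a (k * N) r \<omega>)\<^sup>2) / (real n)\<^sup>2" for \<omega>
    proof -
      have "k * mean N \<le> k * (N * c)"
        using N by (intro mult_left_mono) (auto simp: field_simps)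
      also have "\<dots> \<le> n * c" using \<open>c \<ge> 0\<close> n
        by (metis (mono_tags, opaque_lifting) le_add1 mult.assoc mult_right_mono of_nat_le_iff of_nat_mult)
      finally have "a 0 n \<omega> - n * c \<le> S \<omega> + a (k * N) r \<omega>"
        using a_le_block_sum[of k N r \<omega>] n by (simp add: S_def sum_subtractf)
      then have "(a 0 n \<omega> - n * c) / n \<le> \<bar>S \<omega> + a (k * N) r \<omega>\<bar> / n"
        by (intro divide_right_mono) auto
      then have "max 0 (a 0 n \<omega> / n - c) \<le> \<bar>S \<omega> + a (k * N) r \<omega>\<bar> / n"
        using False by (simp add: diff_divide_distrib)
      then have "excess c n \<omega> \<le> (\<bar>S \<omega> + a (k * N) r \<omega>\<bar> / n)\<^sup>2"
        unfolding excess_def by (rule power_mono) simp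
      also have "\<dots> = (S \<omega> + a (k * N) r \<omega>)\<^sup>2 / (real n)\<^sup>2" by (simp add: power_divide)
      also have "\<dots> \<le> (2 * (S \<omega>)\<^sup>2 + 2 * (a (k * N) r \<omega>)\<^sup>2) / (real n)\<^sup>2"
        using sum_squares_ge_zero[of "S \<omega> - a (k * N) r \<omega>" 0]
        by (intro divide_right_mono) (auto simp: power2_eq_square algebra_simps)
      finally show ?thesis .
    qed
    have "(\<integral>\<omega>. excess c n \<omega> \<partial>M) \<le> (\<integral>\<omega>. (2 * (S \<omega>)\<^sup>2 + 2 * (a (k * N) r \<omega>)\<^sup>2) / (real n)\<^sup>2 \<partial>M)"
      using integrable_excess[OF \<open>c \<ge> 0\<close>] intS square_integrable_a by (intro integral_mono pt) auto
    also have "\<dots> = (2 * (\<integral>\<omega>. (S \<omega>)\<^sup>2 \<partial>M) + 2 * (\<integral>\<omega>. (a (k * N) r \<omega>)\<^sup>2 \<partial>M)) / (real n)\<^sup>2"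
      using intS square_integrable_a by simp
    also have "\<dots> \<le> (2 * (n * ((real N)\<^sup>2 * second_moment)) + 2 * (n * ((real N)\<^sup>2 * second_moment))) / (real n)\<^sup>2"
    proof -
      have "k \<le> n" by (simp add: k_def)
      then have "k * ((real N)\<^sup>2 * second_moment) \<le> n * ((real N)\<^sup>2 * second_moment)" using second_moment_nonneg by (intro mult_right_mono) auto
      moreover have "(real r)\<^sup>2 * second_moment \<le> (real N)\<^sup>2 * second_moment"
        using N second_moment_nonneg by (intro mult_right_mono power_mono) (auto simp: r_def less_imp_le)
      moreover have "1 * ((real N)\<^sup>2 * second_moment) \<le> n * ((real N)\<^sup>2 * second_moment)" using second_moment_nonneg False by (intro mult_right_mono) auto
      moreover have "(\<integral>\<omega>. (a (k * N) r \<omega>)\<^sup>2 \<partial>M) \<le> (real r)\<^sup>2 * second_moment" by (rule square_integral_a_le)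
      ultimately show ?thesis using ES by (intro divide_right_mono[OF _ zero_le_power2]) linarith
    qed
    also have "\<dots> = C / n" using False by (simp add: C_def power2_eq_square)
    finally show ?thesis .
  qed
  moreover have "C \<ge> 0" using second_moment_nonneg by (simp add: C_def)
  ultimately show ?thesis using that by blast
qed

section \<open>Convergence in mean square and the almost sure upper bound\<close>

theorem L2_convergence: "(\<lambda>n. \<integral>\<omega>. (a 0 n \<omega> / n - \<theta>)\<^sup>2 \<partial>M) \<longlonglongrightarrow> 0"
proof (rule tendstoI)
  fix \<delta> :: real assume "\<delta> > 0"
  \<comment> \<open>Chosen so that \<open>2 * \<epsilon>\<^sup>2 + 2 * \<theta> * \<epsilon> \<le>
    \<delta> / 2\<close>; the bound \<open>\<epsilon> \<le> 1\<close> serves to replace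
    \<open>\<epsilon>\<^sup>2\<close> by \<open>\<epsilon>\<close>.\<close>
  define \<epsilon> where "\<epsilon> = min 1 (\<delta> / (4 * (1 + \<theta>)))"
  have pos4: "4 * (1 + \<theta>) > 0" using \<theta>_nonneg by simp
  then have \<epsilon>: "\<epsilon> > 0" "\<epsilon> \<le> 1" "\<epsilon> * (4 * (1 + \<theta>)) \<le> \<delta>"
    using \<open>\<delta> > 0\<close> pos_le_divide_eq[OF pos4, of \<epsilon> \<delta>] by (auto simp: \<epsilon>_def)
  have pos: "\<theta> + \<epsilon> \<ge> 0" using \<theta>_nonneg \<epsilon> by simp
  obtain C where C: "C \<ge> 0" "\<And>n. (\<integral>\<omega>. excess (\<theta> + \<epsilon>) n \<omega> \<partial>M) \<le> C / n"
    using excess_le[of "\<theta> + \<epsilon>"] \<epsilon> by auto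
  have bound: "(\<integral>\<omega>. (a 0 n \<omega> / n - \<theta>)\<^sup>2 \<partial>M) \<le> 2 * \<epsilon>\<^sup>2 + 2 * \<theta> * \<epsilon> + (2 + \<theta> / \<epsilon>) * (C / n)" if "n \<ge> 1" for n
  proof -
    define x where "x = (\<lambda>\<omega>. a 0 n \<omega> / n)"
    have x_nonneg: "x \<omega> \<ge> 0" for \<omega> by (simp add: x_def nonneg)
    \<comment> \<open>The deficit below \<open>\<theta>\<close> is bounded by \<open>\<theta>\<close>, and on average it does not exceed the excess
      because the mean is at least \<open>\<theta>\<close>; hence the term \<open>\<theta> * (\<theta> - x)\<close>, whose integral is nonpositive.\<close>
    have pt: "(x \<omega> - \<theta>)\<^sup>2 \<le> 2 * \<epsilon>\<^sup>2 + \<theta> * \<epsilon> + (2 + \<theta> / \<epsilon>) * excess (\<theta> + \<epsilon>) n \<omega> + \<theta> * (\<theta> - x \<omega>)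
                 + \<theta> * \<epsilon>" for \<omega>
    proof -
      define P where "P = max 0 (x \<omega> - (\<theta> + \<epsilon>))"
      define p where "p = max 0 (x \<omega> - \<theta>)"
      have P: "P \<ge> 0" "p \<le> P + \<epsilon>" "p \<ge> 0" using \<epsilon> by (auto simp: P_def p_def)
      have "p\<^sup>2 \<le> (P + \<epsilon>)\<^sup>2" using P by (intro power_mono) auto
      also have "\<dots> \<le> 2 * P\<^sup>2 + 2 * \<epsilon>\<^sup>2"
        using zero_le_power2[of "P - \<epsilon>"] by (simp add: power2_eq_square algebra_simps)
      finally have 1: "p\<^sup>2 \<le> 2 * P\<^sup>2 + 2 * \<epsilon>\<^sup>2" .
      \<comment> \<open>Trades the first moment of the excess for its second moment, which is the
        one that \<open>excess_le\<close> controls.\<close>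
      have "P \<le> \<epsilon> + P\<^sup>2 / \<epsilon>"
      proof (cases "P \<le> \<epsilon>")
        case True
        then show ?thesis using \<epsilon> by (simp add: add_increasing2)
      next
        case False
        then have "P * \<epsilon> \<le> P * P" using P by (intro mult_left_mono) auto
        then have "P \<le> P\<^sup>2 / \<epsilon>" using \<epsilon> by (simp add: field_simps power2_eq_square)
        then show ?thesis using \<epsilon> by simp
      qed
      then have "p \<le> 2 * \<epsilon> + P\<^sup>2 / \<epsilon>" using P by simp
      then have 2: "\<theta> * p \<le> \<theta> * (2 * \<epsilon> + P\<^sup>2 / \<epsilon>)" using \<theta>_nonneg by (rule mult_left_mono)
      have "(x \<omega> - \<theta>)\<^sup>2 \<le> p\<^sup>2 + \<theta> * p + \<theta> * (\<theta> - x \<omega>)"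
      proof (cases "x \<omega> \<ge> \<theta>")
        case True
        then show ?thesis by (simp add: p_def algebra_simps)
      next
        case False
        then have "(\<theta> - x \<omega>) * (\<theta> - x \<omega>) \<le> \<theta> * (\<theta> - x \<omega>)"
          using x_nonneg by (intro mult_right_mono) auto
        then show ?thesis using False by (simp add: p_def power2_eq_square algebra_simps)
      qed
      then show ?thesis using 1 2 by (simp add: excess_def P_def x_def algebra_simps)
    qed
    have intx: "integrable M x" by (simp add: x_def)
    have intsq: "integrable M (\<lambda>\<omega>. (x \<omega> - \<theta>)\<^sup>2)"
    proof -
      have "(\<lambda>\<omega>. (x \<omega> - \<theta>)\<^sup>2) = (\<lambda>\<omega>. (a 0 n \<omega>)\<^sup>2 / (real n)\<^sup>2 - 2 * \<theta> * (a 0 n \<omega> / n) + \<theta>\<^sup>2)"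
        by (auto simp: x_def power2_eq_square algebra_simps)
      then show ?thesis using square_integrable_a by simp
    qed
    have "(\<integral>\<omega>. (x \<omega> - \<theta>)\<^sup>2 \<partial>M) \<le> (\<integral>\<omega>. 2 * \<epsilon>\<^sup>2 + \<theta> * \<epsilon> + (2 + \<theta> / \<epsilon>) * excess (\<theta> + \<epsilon>) n \<omega>
        + \<theta> * (\<theta> - x \<omega>) + \<theta> * \<epsilon> \<partial>M)"
      using integrable_excess[OF pos] intx by (intro integral_mono intsq pt) simp_all
    also have "\<dots> = 2 * \<epsilon>\<^sup>2 + \<theta> * \<epsilon> + (2 + \<theta> / \<epsilon>) * (\<integral>\<omega>. excess (\<theta> + \<epsilon>) n \<omega> \<partial>M)
        + \<theta> * (\<theta> - mean n / n) + \<theta> * \<epsilon>"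
      using integrable_excess[OF pos] intx by (simp add: prob_space x_def integral_a)
    also have "\<dots> \<le> 2 * \<epsilon>\<^sup>2 + 2 * \<theta> * \<epsilon> + (2 + \<theta> / \<epsilon>) * (C / n)"
    proof -
      have "\<theta> * (\<theta> - mean n / n) \<le> 0"
        using \<theta>_le[OF that] \<theta>_nonneg by (intro mult_nonneg_nonpos) auto
      moreover have "(2 + \<theta> / \<epsilon>) * (\<integral>\<omega>. excess (\<theta> + \<epsilon>) n \<omega> \<partial>M) \<le> (2 + \<theta> / \<epsilon>) * (C / n)"
        using \<theta>_nonneg \<epsilon> by (intro mult_left_mono C) auto
      ultimately show ?thesis by linarith
    qed
    finally show ?thesis by (simp add: x_def)
  qed
  have "(\<lambda>n. (2 + \<theta> / \<epsilon>) * (C / real n)) \<longlonglongrightarrow> (2 + \<theta> / \<epsilon>) * 0"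
    by (intro tendsto_mult tendsto_const lim_const_over_n)
  then have "\<forall>\<^sub>F n in sequentially. (2 + \<theta> / \<epsilon>) * (C / real n) < \<delta> / 2"
    using \<open>\<delta> > 0\<close> by (intro order_tendstoD(2)) auto
  then show "\<forall>\<^sub>F n in sequentially. dist (\<integral>\<omega>. (a 0 n \<omega> / n - \<theta>)\<^sup>2 \<partial>M) 0 < \<delta>"
    using eventually_ge_at_top[of 1]
  proof eventually_elim
    case (elim n)
    have "\<epsilon>\<^sup>2 \<le> \<epsilon>" using \<epsilon> by (simp add: power2_eq_square mult_left_le)
    then have "2 * \<epsilon>\<^sup>2 + 2 * \<theta> * \<epsilon> \<le> \<delta> / 2" using \<epsilon>(3) by (simp add: algebra_simps)
    then have "(\<integral>\<omega>. (a 0 n \<omega> / n - \<theta>)\<^sup>2 \<partial>M) < \<delta>" using bound[OF elim(2)] elim(1) by linarith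
    then show ?case by (simp add: integral_nonneg_AE)
  qed
qed

text \<open>Chebyshev's inequality is summable along the squares, and the gap from \<open>k\<^sup>2\<close> to the next square is
  bridged by at most \<open>2 * k + 1\<close> single steps.\<close>
lemma AE_eventually_less:
  assumes "c > \<theta>"
  shows "AE \<omega> in M. \<forall>\<^sub>F n in sequentially. a 0 n \<omega> / n < c"
proof -
  define c' where "c' = (\<theta> + c) / 2"
  have c': "\<theta> < c'" "c' < c" "0 \<le> c'" using assms \<theta>_nonneg by (auto simp: c'_def)
  obtain C where C: "C \<ge> 0" "\<And>n. (\<integral>\<omega>. excess c' n \<omega> \<partial>M) \<le> C / n"
    using excess_le[OF c'(1)] by blast
  have sq: "summable (\<lambda>k. B * (1 / (real k)\<^sup>2))" for B :: real
    by (intro summable_mult) (use inverse_power_summable[of 2] in \<open>simp add: inverse_eq_divide\<close>)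
  have 1: "AE \<omega> in M. (\<lambda>k. excess c' (k\<^sup>2) \<omega>) \<longlonglongrightarrow> 0"
  proof (rule AE_tendsto_zero_if_summable_integral[OF _ _ _ sq[of C]])
    show "integrable M (excess c' (k\<^sup>2))" for k using c' by (intro integrable_excess)
    show "0 \<le> excess c' (k\<^sup>2) \<omega>" for k \<omega> by (simp add: excess_def)
    show "(\<integral>\<omega>. excess c' (k\<^sup>2) \<omega> \<partial>M) \<le> C * (1 / (real k)\<^sup>2)" for k using C(2)[of "k\<^sup>2"] by simp
  qed
  \<comment> \<open>One sum of single steps serves all \<open>n\<close> between two consecutive
    squares at once, so a single null set is enough.\<close>
  define D where "D k \<omega> = (\<Sum>i<2 * k + 1. a (k\<^sup>2 + i) 1 \<omega>)" for k \<omega>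
  have D_nonneg: "D k \<omega> \<ge> 0" for k \<omega> by (simp add: D_def nonneg sum_nonneg)
  have 2: "AE \<omega> in M. (\<lambda>k. (D k \<omega> / (real k)\<^sup>2)\<^sup>2) \<longlonglongrightarrow> 0"
  proof (rule AE_tendsto_zero_if_summable_integral[OF _ _ _ sq[of "9 * second_moment"]])
    fix k
    show "integrable M (\<lambda>\<omega>. (D k \<omega> / (real k)\<^sup>2)\<^sup>2)"
      unfolding D_def power_divide by (intro integrable_divide_zero square_sum_singles(1))
    have "(\<integral>\<omega>. (D k \<omega> / (real k)\<^sup>2)\<^sup>2 \<partial>M) = (\<integral>\<omega>. (D k \<omega>)\<^sup>2 \<partial>M) / (real k) ^ 4"
      by (simp add: power_divide)
    also have "\<dots> \<le> ((3 * real k)\<^sup>2 * second_moment) / (real k) ^ 4"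
    \<comment> \<open>For \<open>k \<ge> 1\<close> the constant comes from
      \<open>2 * k + 1 \<le> 3 * k\<close>; for \<open>k = 0\<close> both sides are 0 by division by
      zero.\<close>
    proof (cases "k = 0")
      case False
      have "(\<integral>\<omega>. (D k \<omega>)\<^sup>2 \<partial>M) \<le> (real (2 * k + 1))\<^sup>2 * second_moment"
        unfolding D_def by (rule square_sum_singles(2))
      also have "\<dots> \<le> (3 * real k)\<^sup>2 * second_moment"
        using False second_moment_nonneg by (intro mult_right_mono power_mono) auto
      finally show ?thesis by (intro divide_right_mono) auto
    qed simp
    also have "\<dots> = 9 * second_moment * (1 / (real k)\<^sup>2)" by (simp add: power2_eq_square power4_eq_xxxx)
    finally show "(\<integral>\<omega>. (D k \<omega> / (real k)\<^sup>2)\<^sup>2 \<partial>M) \<le> 9 * second_moment * (1 / (real k)\<^sup>2)" .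
  qed auto
  have sqrt_top: "filterlim floor_sqrt at_top sequentially"
    unfolding filterlim_at_top eventually_sequentially
    by (metis floor_sqrt_inverse_power2 mono_floor_sqrt')
  from 1 2 show ?thesis
  proof eventually_elim
    case (elim \<omega>)
    \<comment> \<open>One \<open>\<eta>\<close> is spent on the deviation above \<open>c'\<close> at
      the square and one on the steps \<open>D k\<close>; together they add up to
      \<open>c - c'\<close>.\<close>
    define \<eta> where "\<eta> = (c - c') / 2"
    have "\<eta> > 0" using c' by (simp add: \<eta>_def)
    have "\<forall>\<^sub>F k in sequentially. excess c' (k\<^sup>2) \<omega> < \<eta>\<^sup>2"
      by (rule order_tendstoD(2)[OF elim(1)]) (use \<open>\<eta> > 0\<close> in simp)
    moreover have "\<forall>\<^sub>F k in sequentially. (D k \<omega> / (real k)\<^sup>2)\<^sup>2 < \<eta>\<^sup>2"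
      by (rule order_tendstoD(2)[OF elim(2)]) (use \<open>\<eta> > 0\<close> in simp)
    moreover have "\<forall>\<^sub>F k::nat in sequentially. k \<ge> 1" by (rule eventually_ge_at_top)
    ultimately have "\<forall>\<^sub>F k in sequentially. \<forall>n. k\<^sup>2 \<le> n \<and> n < (Suc k)\<^sup>2 \<longrightarrow> a 0 n \<omega> / n < c"
    proof eventually_elim
      case (elim k)
      have k: "real k > 0" using elim by simp
      have "max 0 (a 0 (k\<^sup>2) \<omega> / (real k)\<^sup>2 - c') < \<eta>"
        using power2_less_imp_less[of "max 0 (a 0 (k\<^sup>2) \<omega> / (real k)\<^sup>2 - c')" \<eta>] elim(1) \<open>\<eta> > 0\<close>
        by (simp add: excess_def)
      then have "a 0 (k\<^sup>2) \<omega> / (real k)\<^sup>2 < c' + \<eta>" by simp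
      then have A: "a 0 (k\<^sup>2) \<omega> < (c' + \<eta>) * (real k)\<^sup>2" using k by (simp add: field_simps)
      have "D k \<omega> / (real k)\<^sup>2 < \<eta>"
        using power2_less_imp_less[OF elim(2)] \<open>\<eta> > 0\<close> by simp
      then have B: "D k \<omega> < \<eta> * (real k)\<^sup>2" using k by (simp add: field_simps)
      show ?case
      proof (intro allI impI, elim conjE)
        fix n assume n: "k\<^sup>2 \<le> n" "n < (Suc k)\<^sup>2"
        then have n': "n = k\<^sup>2 + (n - k\<^sup>2)" "n - k\<^sup>2 \<le> 2 * k + 1" by (auto simp: power2_eq_square)
        have "a 0 n \<omega> \<le> a 0 (k\<^sup>2) \<omega> + a (k\<^sup>2) (n - k\<^sup>2) \<omega>"
          using subadd[of 0 "k\<^sup>2" "n - k\<^sup>2" \<omega>] n' by simp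
        also have "a (k\<^sup>2) (n - k\<^sup>2) \<omega> \<le> (\<Sum>i<n - k\<^sup>2. a (k\<^sup>2 + i) 1 \<omega>)"
          by (rule a_le_sum)
        also have "\<dots> \<le> D k \<omega>"
          unfolding D_def using n' nonneg by (intro sum_mono2) auto
        finally have "a 0 n \<omega> < (c' + \<eta>) * (real k)\<^sup>2 + \<eta> * (real k)\<^sup>2" using A B by linarith
        also have "\<dots> = c * (real k)\<^sup>2" by (simp add: \<eta>_def field_simps)
        also have "\<dots> \<le> c * real n"
          using n(1) c' by (intro mult_left_mono) (auto simp flip: of_nat_power)
        finally show "a 0 n \<omega> / n < c" using k n(1)
          by (smt (verit, best) divide_less_eq of_nat_0_less_iff of_nat_le_0_iff of_nat_power zero_less_power not_less of_nat_le_iff)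
      qed
    qed
    \<comment> \<open>Every \<open>n\<close> lies in the gap that starts at the square of its
      integer root. As this root tends to infinity, the statement about late gaps becomes one about
      all large \<open>n\<close>.\<close>
    then have "\<forall>\<^sub>F n in sequentially. \<forall>m. (floor_sqrt n)\<^sup>2 \<le> m \<and> m < (Suc (floor_sqrt n))\<^sup>2 \<longrightarrow> a 0 m \<omega> / m < c"
      using sqrt_top by (rule eventually_compose_filterlim)
    then show ?case
      by eventually_elim (use Suc_floor_sqrt_power2_gt in auto)
  qed
qed

section \<open>Lower limits of rows and almost sure convergence\<close>

text \<open>Made real so that it can be integrated. An infinite lower limit would be sent to 0;
  \<open>AE_row_liminf\<close> shows that this happens only on a null set.\<close>

definition "row_liminf x = real_of_ereal (liminf (\<lambda>n. ereal (x n / real n)))"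

lemma row_liminf_measurable [measurable]: "row_liminf \<in> borel_measurable (PiM UNIV (\<lambda>_. borel))"
  unfolding row_liminf_def[abs_def] by measurable

text \<open>For row 0 the upper bound comes from \<open>AE_eventually_less\<close> at the thresholds
  \<open>\<theta> + 1 / Suc j\<close>; stationarity carries it to row \<open>m\<close>. With
  nonnegativity the lower limit is finite.\<close>

lemma AE_row_liminf:
  "AE \<omega> in M. liminf (\<lambda>n. ereal (a m n \<omega> / real n)) = ereal (row_liminf (\<lambda>n. a m n \<omega>)) \<and>
              0 \<le> row_liminf (\<lambda>n. a m n \<omega>) \<and> row_liminf (\<lambda>n. a m n \<omega>) \<le> \<theta>"
proof -
  have "AE \<omega> in M. \<forall>j. \<forall>\<^sub>F n in sequentially. a 0 n \<omega> / n < \<theta> + 1 / Suc j"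
    by (subst AE_all_countable) (auto intro!: AE_eventually_less)
  then have "AE \<omega> in M. liminf (\<lambda>n. ereal (a 0 n \<omega> / real n)) \<le> ereal \<theta>"
  proof eventually_elim
    case (elim \<omega>)
    show ?case
    proof (rule ereal_le_epsilon2)
      fix \<epsilon> :: real assume "\<epsilon> > 0"
      then obtain j where j: "1 / real (Suc j) < \<epsilon>"
        using nat_approx_posE by blast
      have "\<forall>\<^sub>F n in sequentially. ereal (a 0 n \<omega> / real n) \<le> ereal (\<theta> + \<epsilon>)"
        using elim[rule_format, of j] by eventually_elim (use j in auto)
      then show "liminf (\<lambda>n. ereal (a 0 n \<omega> / real n)) \<le> ereal \<theta> + ereal \<epsilon>"
        by (intro Liminf_le) auto
    qed
  qed
  then have "AE \<omega> in M. liminf (\<lambda>n. ereal (a m n \<omega> / real n)) \<le> ereal \<theta>"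
    by (subst AE_shift[where P = "\<lambda>x. liminf (\<lambda>n. ereal (x n / real n)) \<le> ereal \<theta>"]) simp_all
  then show ?thesis
  proof eventually_elim
    case (elim \<omega>)
    have "0 \<le> liminf (\<lambda>n. ereal (a m n \<omega> / real n))"
      by (intro Liminf_bounded) (simp add: nonneg)
    with elim show ?case
      unfolding row_liminf_def by (cases "liminf (\<lambda>n. ereal (a m n \<omega> / real n))") auto
  qed
qed

lemma integrable_row_liminf: "integrable M (\<lambda>\<omega>. row_liminf (\<lambda>n. a m n \<omega>))"
proof (rule integrable_const_bound)
  show "AE \<omega> in M. norm (row_liminf (\<lambda>n. a m n \<omega>)) \<le> \<theta>"
    using AE_row_liminf[of m] by eventually_elim simp
qed simp

text \<open>Subadditivity makes the lower limits monotone in the starting point; being equidistributed and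
  bounded, they coincide almost surely.\<close>
lemma AE_row_liminf_Suc: "AE \<omega> in M. row_liminf (\<lambda>n. a (Suc m) n \<omega>) = row_liminf (\<lambda>n. a m n \<omega>)"
proof -
  have mono: "AE \<omega> in M. 0 \<le> row_liminf (\<lambda>n. a (Suc m) n \<omega>) - row_liminf (\<lambda>n. a m n \<omega>)"
    using AE_row_liminf[of m] AE_row_liminf[of "Suc m"]
  proof eventually_elim
    case (elim \<omega>)
    have "liminf (\<lambda>n. ereal (a m n \<omega> / n)) = liminf (\<lambda>n. ereal (a m (Suc n) \<omega> / Suc n))"
      using liminf_shift[of "\<lambda>n. ereal (a m n \<omega> / n)"] by simp
    also have "\<dots> \<le> liminf (\<lambda>n. ereal (a m 1 \<omega> / Suc n) + ereal (a (Suc m) n \<omega> / n))"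
    proof (intro Liminf_mono always_eventually allI)
      fix n
      have "a m (Suc n) \<omega> / Suc n \<le> (a m 1 \<omega> + a (Suc m) n \<omega>) / Suc n"
        using subadd[of m 1 n \<omega>] by (intro divide_right_mono) auto
      also have "\<dots> = a m 1 \<omega> / Suc n + a (Suc m) n \<omega> / Suc n" by (rule add_divide_distrib)
      also have "a (Suc m) n \<omega> / Suc n \<le> a (Suc m) n \<omega> / n"
        by (cases "n = 0") (auto simp: zero nonneg intro!: divide_left_mono)
      finally show "ereal (a m (Suc n) \<omega> / Suc n) \<le> ereal (a m 1 \<omega> / Suc n) + ereal (a (Suc m) n \<omega> / n)"
        by simp
    qed
    also have "\<dots> = 0 + liminf (\<lambda>n. ereal (a (Suc m) n \<omega> / n))"
    proof (rule ereal_liminf_lim_add)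
      have "(\<lambda>n. a m 1 \<omega> / real (Suc n)) \<longlonglongrightarrow> 0"
        by (rule LIMSEQ_Suc[OF lim_const_over_n])
      then show "(\<lambda>n. ereal (a m 1 \<omega> / real (Suc n))) \<longlonglongrightarrow> 0"
        by (simp add: zero_ereal_def)
    qed simp
    finally show ?case using elim by simp
  qed
  have "(\<integral>\<omega>. row_liminf (\<lambda>n. a (Suc m) n \<omega>) - row_liminf (\<lambda>n. a m n \<omega>) \<partial>M) = 0"
    using integrable_row_liminf integral_shift[of row_liminf "Suc m"] integral_shift[of row_liminf m] by simp
  then have "AE \<omega> in M. row_liminf (\<lambda>n. a (Suc m) n \<omega>) - row_liminf (\<lambda>n. a m n \<omega>) = 0"
    using integral_nonneg_eq_0_iff_AE[OF _ mono] integrable_row_liminf by simp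
  then show ?thesis by eventually_elim simp
qed

lemma AE_row_liminf_all: "AE \<omega> in M. \<forall>m. row_liminf (\<lambda>n. a m n \<omega>) = row_liminf (\<lambda>n. a 0 n \<omega>)"
proof -
  have "AE \<omega> in M. \<forall>m. row_liminf (\<lambda>n. a (Suc m) n \<omega>) = row_liminf (\<lambda>n. a m n \<omega>)"
    by (subst AE_all_countable) (use AE_row_liminf_Suc in blast)
  then show ?thesis
  proof eventually_elim
    case (elim \<omega>)
    have "row_liminf (\<lambda>n. a m n \<omega>) = row_liminf (\<lambda>n. a 0 n \<omega>)" for m
      by (induction m) (use elim in simp_all)
    then show ?case by blast
  qed
qed

text \<open>The penalty for a bad starting point in \<open>greedy_bound\<close>, written as a
  function of one row alone. Stationarity then gives it the same expectation at every starting
  point.\<close>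

definition "bad \<epsilon> K x = (if \<forall>l\<in>{1..K}. x l > (row_liminf x + \<epsilon>) * real l then x 1 else (0::real))"

lemma bad_measurable [measurable]: "bad \<epsilon> K \<in> borel_measurable (PiM UNIV (\<lambda>_. borel))"
  unfolding bad_def[abs_def] by measurable

lemma integrable_bad: "integrable M (\<lambda>\<omega>. bad \<epsilon> K (\<lambda>n. a m n \<omega>))"
  by (rule Bochner_Integration.integrable_bound[OF integrable_a[of m 1]])
     (auto simp: bad_def nonneg)

text \<open>The threshold exceeds the lower limit by \<open>\<epsilon>\<close>, so some block length
  \<open>l\<close> stays below it and the penalty vanishes once \<open>K \<ge> l\<close>. It is
  dominated by \<open>a 0 1\<close>.\<close>

lemma bad_tendsto:
  assumes "\<epsilon> > 0"
  shows "(\<lambda>K. \<integral>\<omega>. bad \<epsilon> K (\<lambda>n. a 0 n \<omega>) \<partial>M) \<longlonglongrightarrow> 0"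
proof -
  have "(\<lambda>K. \<integral>\<omega>. bad \<epsilon> K (\<lambda>n. a 0 n \<omega>) \<partial>M) \<longlonglongrightarrow> (\<integral>\<omega>. 0 \<partial>M)"
  proof (rule integral_dominated_convergence[OF _ _ integrable_a[of 0 1]])
    show "AE \<omega> in M. (\<lambda>K. bad \<epsilon> K (\<lambda>n. a 0 n \<omega>)) \<longlonglongrightarrow> 0"
      using AE_row_liminf[of 0]
    proof eventually_elim
      case (elim \<omega>)
      let ?y = "row_liminf (\<lambda>n. a 0 n \<omega>)"
      have "\<exists>l\<ge>1. a 0 l \<omega> \<le> (?y + \<epsilon>) * l"
      proof (rule ccontr)
        assume *: "\<not> ?thesis"
        have "\<forall>\<^sub>F l in sequentially. ereal (?y + \<epsilon>) \<le> ereal (a 0 l \<omega> / real l)"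
          using eventually_ge_at_top[of 1] by eventually_elim (use * in \<open>force simp: field_simps\<close>)
        then have "ereal (?y + \<epsilon>) \<le> liminf (\<lambda>l. ereal (a 0 l \<omega> / real l))" by (rule Liminf_bounded)
        then show False using elim assms by simp
      qed
      then obtain l where l: "l \<ge> 1" "a 0 l \<omega> \<le> (?y + \<epsilon>) * l" by blast
      have "\<forall>\<^sub>F K in sequentially. bad \<epsilon> K (\<lambda>n. a 0 n \<omega>) = 0"
        using eventually_ge_at_top[of l] by eventually_elim (use l in \<open>force simp: bad_def\<close>)
      then show ?case by (rule tendsto_eventually)
    qed
    show "AE \<omega> in M. norm (bad \<epsilon> K (\<lambda>n. a 0 n \<omega>)) \<le> a 0 1 \<omega>" for K
      by (auto simp: bad_def nonneg)
  qed simp_all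
  then show ?thesis by simp
qed

text \<open>Integrate the greedy bound at level \<open>row_liminf + \<epsilon>\<close> and divide by
  \<open>n\<close>. Letting \<open>n\<close> grow removes the boundary term, and then letting
  \<open>K\<close> grow removes the bad starting points.\<close>

lemma \<theta>_le_row_liminf: "\<theta> \<le> (\<integral>\<omega>. row_liminf (\<lambda>n. a 0 n \<omega>) \<partial>M)"
proof (rule field_le_epsilon)
  fix \<epsilon> :: real assume "\<epsilon> > 0"
  let ?L = "\<integral>\<omega>. row_liminf (\<lambda>n. a 0 n \<omega>) \<partial>M"
  let ?B = "\<lambda>K. \<integral>\<omega>. bad \<epsilon> K (\<lambda>n. a 0 n \<omega>) \<partial>M"
  have "mean n \<le> (?L + \<epsilon>) * n + n * ?B K + K * mean 1" for n K
  proof -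
    have "mean n \<le> (\<integral>\<omega>. (row_liminf (\<lambda>n. a 0 n \<omega>) + \<epsilon>) * n + (\<Sum>i\<in>{0..<n}. bad \<epsilon> K (\<lambda>l. a i l \<omega>))
        + (\<Sum>i\<in>{n - K..<n}. a i 1 \<omega>) \<partial>M)"
      unfolding mean_def
    proof (rule integral_mono_AE)
      show "AE \<omega> in M. a 0 n \<omega> \<le> (row_liminf (\<lambda>n. a 0 n \<omega>) + \<epsilon>) * n
          + (\<Sum>i\<in>{0..<n}. bad \<epsilon> K (\<lambda>l. a i l \<omega>)) + (\<Sum>i\<in>{n - K..<n}. a i 1 \<omega>)"
        using AE_row_liminf_all AE_row_liminf[of 0]
      proof eventually_elim
        case (elim \<omega>)
        \<comment> \<open>Each row is judged by its own lower limit, but almost surely all of these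
          agree with that of row 0, so a single level \<open>y\<close> fits
          \<open>greedy_bound\<close>.\<close>
        have "bad \<epsilon> K (\<lambda>l. a i l \<omega>) =
            (if \<forall>l\<in>{1..K}. a i l \<omega> > (row_liminf (\<lambda>n. a 0 n \<omega>) + \<epsilon>) * l then a i 1 \<omega> else 0)" for i
          unfolding bad_def elim(1)[rule_format, of i] ..
        then show ?case
          using elim(2) greedy_bound[of "\<lambda>m n. a m n \<omega>" "row_liminf (\<lambda>n. a 0 n \<omega>) + \<epsilon>" 0 n K]
            nonneg zero subadd a_le_sum \<open>\<epsilon> > 0\<close> by simp
      qed
    qed (use integrable_row_liminf integrable_bad in auto)
    also have "\<dots> = (?L + \<epsilon>) * n + n * ?B K + card {n - K..<n} * mean 1"
    proof -
      have "(\<Sum>i\<in>{0..<n}. \<integral>\<omega>. bad \<epsilon> K (\<lambda>l. a i l \<omega>) \<partial>M) = (\<Sum>i\<in>{0..<n}. ?B K)"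
        by (intro sum.cong refl integral_shift bad_measurable)
      then show ?thesis
        using integrable_row_liminf integrable_bad by (simp add: prob_space integral_a)
    qed
    also have "\<dots> \<le> (?L + \<epsilon>) * n + n * ?B K + K * mean 1"
      using mean_nonneg by (intro add_left_mono mult_right_mono) auto
    finally show ?thesis .
  qed
  then have *: "mean n / n \<le> (?L + \<epsilon>) + ?B K + K * mean 1 / n" if "n \<ge> 1" for n K
    using that by (simp add: field_simps)
  have "\<theta> \<le> (?L + \<epsilon>) + ?B K" for K
  proof (rule LIMSEQ_le[OF mean_tendsto])
    have "(\<lambda>n. (?L + \<epsilon>) + ?B K + K * mean 1 / n) \<longlonglongrightarrow> (?L + \<epsilon>) + ?B K + 0"
      by (intro tendsto_intros lim_const_over_n)
    then show "(\<lambda>n. (?L + \<epsilon>) + ?B K + K * mean 1 / n) \<longlonglongrightarrow> (?L + \<epsilon>) + ?B K" by simp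
    show "\<exists>N. \<forall>n\<ge>N. mean n / n \<le> (?L + \<epsilon>) + ?B K + K * mean 1 / n" using * by blast
  qed
  moreover have "(\<lambda>K. (?L + \<epsilon>) + ?B K) \<longlonglongrightarrow> (?L + \<epsilon>) + 0"
    by (intro tendsto_intros bad_tendsto \<open>\<epsilon> > 0\<close>)
  ultimately show "\<theta> \<le> ?L + \<epsilon>" by (intro LIMSEQ_le_const[of _ "?L + \<epsilon>"]) auto
qed

text \<open>The lower limit is at most \<open>\<theta>\<close> almost surely and has mean at least
  \<open>\<theta>\<close>, so it equals \<open>\<theta>\<close> almost surely. The matching upper
  bound is \<open>AE_eventually_less\<close> along a countable set of thresholds.\<close>

theorem AE_convergence: "AE \<omega> in M. (\<lambda>n. a 0 n \<omega> / n) \<longlonglongrightarrow> \<theta>"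
proof -
  have "AE \<omega> in M. 0 \<le> \<theta> - row_liminf (\<lambda>n. a 0 n \<omega>)"
    using AE_row_liminf[of 0] by eventually_elim simp
  moreover have int: "integrable M (\<lambda>\<omega>. \<theta> - row_liminf (\<lambda>n. a 0 n \<omega>))" using integrable_row_liminf by simp
  ultimately have "(\<integral>\<omega>. \<theta> - row_liminf (\<lambda>n. a 0 n \<omega>) \<partial>M) \<ge> 0" by (intro integral_nonneg_AE)
  moreover have "(\<integral>\<omega>. \<theta> - row_liminf (\<lambda>n. a 0 n \<omega>) \<partial>M) \<le> 0"
    using \<theta>_le_row_liminf integrable_row_liminf by (simp add: prob_space)
  ultimately have "AE \<omega> in M. \<theta> - row_liminf (\<lambda>n. a 0 n \<omega>) = 0"
    using integral_nonneg_eq_0_iff_AE[OF int] \<open>AE \<omega> in M. 0 \<le> \<theta> - row_liminf (\<lambda>n. a 0 n \<omega>)\<close> by simp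
  moreover have "AE \<omega> in M. \<forall>j. \<forall>\<^sub>F n in sequentially. a 0 n \<omega> / n < \<theta> + 1 / Suc j"
    by (subst AE_all_countable) (auto intro!: AE_eventually_less)
  ultimately show ?thesis using AE_row_liminf[of 0]
  proof eventually_elim
    case (elim \<omega>)
    show ?case
    proof (rule order_tendstoI)
      fix y assume "y < \<theta>"
      then have "ereal y < liminf (\<lambda>n. ereal (a 0 n \<omega> / n))" using elim by simp
      then show "\<forall>\<^sub>F n in sequentially. y < a 0 n \<omega> / n"
        using less_LiminfD by fastforce
    next
      fix y assume "\<theta> < y"
      then obtain j where j: "1 / real (Suc j) < y - \<theta>" using nat_approx_posE[of "y - \<theta>"] by auto
      show "\<forall>\<^sub>F n in sequentially. a 0 n \<omega> / n < y"
        using elim(2)[rule_format, of j] by eventually_elim (use j in auto)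
    qed
  qed
qed

end

section \<open>Planar matchings\<close>

lemma chain_inj:
  fixes P :: "(nat \<times> nat) set"
  assumes chain: "\<forall>p\<in>P. \<forall>q\<in>P. fst p < fst q \<longleftrightarrow> snd p < snd q"
  shows "inj_on fst P" "inj_on snd P"
proof -
  have "p = q" if "p \<in> P" "q \<in> P" "fst p = fst q \<or> snd p = snd q" for p q
    using that(3) bspec[OF bspec[OF chain that(1)] that(2)] bspec[OF bspec[OF chain that(2)] that(1)]
    by (auto simp: prod_eq_iff)
  then show "inj_on fst P" "inj_on snd P"
    by (auto simp: inj_on_def)
qed

text \<open>A description without indexing, so that unions and translates can be checked edge by
  edge. For the converse, the edges are listed by increasing top vertex.\<close>

lemma planar_matching_iff:
  "planar_matching n P \<longleftrightarrow> P \<subseteq> K_bip n \<and> (\<forall>p\<in>P. \<forall>q\<in>P. fst p < fst q \<longleftrightarrow> snd p < snd q)"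
proof
  assume "planar_matching n P"
  then obtain t :: nat and i j where "P \<subseteq> K_bip n" and i: "strict_mono_on {1..t} i"
    and j: "strict_mono_on {1..t} j" and P: "P = (\<lambda>k. (i k, j k)) ` {1..t}"
    unfolding planar_matching_def by blast
  then show "P \<subseteq> K_bip n \<and> (\<forall>p\<in>P. \<forall>q\<in>P. fst p < fst q \<longleftrightarrow> snd p < snd q)"
    using strict_mono_on_less[OF i] strict_mono_on_less[OF j] by auto
next
  assume *: "P \<subseteq> K_bip n \<and> (\<forall>p\<in>P. \<forall>q\<in>P. fst p < fst q \<longleftrightarrow> snd p < snd q)"
  then have "finite P" by (auto simp: K_bip_def intro: finite_subset)
  have inj: "inj_on fst P"
    using * by (intro chain_inj) blast
  define t where "t = card (fst ` P)"
  obtain h where h: "bij_betw h {..<t} (fst ` P)" "strict_mono_on {..<t} h"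
    using ex_bij_betw_strict_mono_card[of "fst ` P"] \<open>finite P\<close> unfolding t_def by blast
  \<comment> \<open>The enumeration \<open>h\<close> starts at 0, whereas the indices of a planar
    matching start at 1.\<close>
  define g where "g k = inv_into P fst (h (k - 1))" for k
  have image: "(\<lambda>k. h (k - 1)) ` {1..t} = fst ` P"
  proof -
    have "(\<lambda>k. k - 1) ` {1..t} = {..<t}"
      by (auto simp: image_iff intro!: bexI[of _ "Suc _"])
    then have "(\<lambda>k. h (k - 1)) ` {1..t} = h ` {..<t}" by (metis image_image)
    then show ?thesis using h(1) by (simp add: bij_betw_def)
  qed
  have g: "g k \<in> P" "fst (g k) = h (k - 1)" if "k \<in> {1..t}" for k
  proof -
    have "h (k - 1) \<in> fst ` P" using image that by blast
    then show "g k \<in> P" "fst (g k) = h (k - 1)"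
      unfolding g_def by (auto intro: inv_into_into f_inv_into_f)
  qed
  have "g ` {1..t} = P"
  proof
    show "P \<subseteq> g ` {1..t}"
    proof
      fix p assume "p \<in> P"
      then have "fst p \<in> (\<lambda>k. h (k - 1)) ` {1..t}" unfolding image by (rule imageI)
      then obtain k where "fst p = h (k - 1)" "k \<in> {1..t}" by (rule imageE)
      then have "g k = p" unfolding g_def using inv_into_f_f[OF inj \<open>p \<in> P\<close>] by simp
      then show "p \<in> g ` {1..t}" using \<open>k \<in> {1..t}\<close> by blast
    qed
  qed (use g in blast)
  moreover have i: "strict_mono_on {1..t} (\<lambda>k. fst (g k))"
  proof (rule strict_mono_onI)
    fix k l assume "k \<in> {1..t}" "l \<in> {1..t}" "k < l"
    then have "h (k - 1) < h (l - 1)"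
      using strict_mono_on_less[OF h(2), of "k - 1" "l - 1"] by auto
    then show "fst (g k) < fst (g l)" using g \<open>k \<in> {1..t}\<close> \<open>l \<in> {1..t}\<close> by simp
  qed
  moreover have "strict_mono_on {1..t} (\<lambda>k. snd (g k))"
  proof (rule strict_mono_onI)
    fix k l assume kl: "k \<in> {1..t}" "l \<in> {1..t}" "k < l"
    then have "fst (g k) < fst (g l)" using strict_mono_onD[OF i] by blast
    then show "snd (g k) < snd (g l)" using * g(1) kl by blast
  qed
  ultimately show "planar_matching n P"
    unfolding planar_matching_def using *
    by (intro conjI exI[of _ t] exI[of _ "\<lambda>k. fst (g k)"] exI[of _ "\<lambda>k. snd (g k)"]) auto
qed

section \<open>Minimum weight over feasible matchings\<close>

definition feasible :: "nat \<Rightarrow> real \<Rightarrow> (nat \<times> nat) set set" where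
  "feasible n r = {P. planar_matching n P \<and> r \<le> real (card P)}"

lemma finite_K_bip [simp]: "finite (K_bip n)"
  by (simp add: K_bip_def)

lemma feasible_subset: "P \<in> feasible n r \<Longrightarrow> P \<subseteq> K_bip n"
  by (simp add: feasible_def planar_matching_def)

lemma finite_feasible [simp]: "finite (feasible n r)"
  by (rule finite_subset[of _ "Pow (K_bip n)"]) (auto dest: feasible_subset)

lemma finite_planar [dest]: "P \<in> feasible n r \<Longrightarrow> finite P"
  by (rule finite_subset[OF feasible_subset finite_K_bip])

lemma diagonal_feasible: "r \<le> real n \<Longrightarrow> (\<lambda>k. (k, k)) ` {1..n} \<in> feasible n r"
  by (auto simp: feasible_def planar_matching_iff K_bip_def card_image inj_on_def)

lemma min_weight_eq: "min_weight w n r \<omega> = Min ((\<lambda>P. \<Sum>f\<in>P. w f \<omega>) ` feasible n r)"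
  by (simp add: min_weight_def feasible_def)

lemma min_weight_le: "P \<in> feasible n r \<Longrightarrow> min_weight w n r \<omega> \<le> (\<Sum>f\<in>P. w f \<omega>)"
  unfolding min_weight_eq by (intro Min_le) auto

lemma min_weight_attained:
  assumes "r \<le> real n"
  obtains P where "P \<in> feasible n r" "min_weight w n r \<omega> = (\<Sum>f\<in>P. w f \<omega>)"
proof -
  have "min_weight w n r \<omega> \<in> (\<lambda>P. \<Sum>f\<in>P. w f \<omega>) ` feasible n r"
    unfolding min_weight_eq by (intro Min_in) (use diagonal_feasible[OF assms] in auto)
  then show ?thesis using that by blast
qed

text \<open>The two sample points may live in different spaces. This permits reading a minimum
  weight as a function of the coordinates of a product space.\<close>

lemma min_weight_cong:
  assumes "\<And>f. f \<in> K_bip n \<Longrightarrow> w f \<omega> = w' f \<omega>'"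
  shows "min_weight w n r \<omega> = min_weight w' n r \<omega>'"
  unfolding min_weight_eq
  by (intro arg_cong[where f = Min] image_cong sum.cong refl) (use assms feasible_subset in blast)

lemma min_weight_measurable:
  assumes "\<And>f. f \<in> K_bip n \<Longrightarrow> w f \<in> borel_measurable M"
  shows "min_weight w n r \<in> borel_measurable M"
proof -
  have "min_weight w n r = (\<lambda>\<omega>. Min ((\<lambda>P. \<Sum>f\<in>P. w f \<omega>) ` feasible n r))"
    by (simp add: min_weight_eq fun_eq_iff)
  also have "\<dots> \<in> borel_measurable M"
    by (intro borel_measurable_Min borel_measurable_sum finite_feasible)
       (use assms feasible_subset in blast)
  finally show ?thesis .
qed

lemma min_weight_nonneg:
  assumes "r \<le> real n" "\<And>f. 0 \<le> w f \<omega>"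
  shows "0 \<le> min_weight w n r \<omega>"
  using assms by (metis min_weight_attained sum_nonneg)

lemma min_weight_mono:
  assumes "r \<le> s" "s \<le> real n"
  shows "min_weight w n r \<omega> \<le> min_weight w n s \<omega>"
proof -
  obtain P where "P \<in> feasible n s" "min_weight w n s \<omega> = (\<Sum>f\<in>P. w f \<omega>)"
    using min_weight_attained[OF assms(2)] .
  then show ?thesis using min_weight_le[of P n r w \<omega>] assms by (simp add: feasible_def)
qed

section \<open>Concatenation of matchings\<close>

definition translate :: "nat \<Rightarrow> nat \<times> nat \<Rightarrow> nat \<times> nat" where
  "translate m f = (fst f + m, snd f + m)"

lemma inj_translate: "inj_on (translate m) A"
  by (auto simp: inj_on_def translate_def prod_eq_iff)

text \<open>Each translated edge exceeds each edge of \<open>P\<close> in both coordinates, so mixed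
  pairs are ordered consistently and the two sets are disjoint.\<close>

lemma feasible_concat:
  assumes P: "P \<in> feasible m r" and Q: "Q \<in> feasible n s"
  shows "P \<union> translate m ` Q \<in> feasible (m + n) (r + s)" "P \<inter> translate m ` Q = {}"
proof -
  have P': "P \<subseteq> K_bip m" "\<forall>p\<in>P. \<forall>q\<in>P. fst p < fst q \<longleftrightarrow> snd p < snd q"
    and Q': "Q \<subseteq> K_bip n" "\<forall>p\<in>Q. \<forall>q\<in>Q. fst p < fst q \<longleftrightarrow> snd p < snd q"
    using P Q by (simp_all add: feasible_def planar_matching_iff)
  have P1: "fst p \<in> {1..m}" "snd p \<in> {1..m}" if "p \<in> P" for p
    using P'(1) that by (force simp: K_bip_def)+
  have Q1: "fst q \<in> {1..n}" "snd q \<in> {1..n}" if "q \<in> Q" for q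
    using Q'(1) that by (force simp: K_bip_def)+
  have T: "fst (translate m q) = fst q + m" "snd (translate m q) = snd q + m" for q
    by (simp_all add: translate_def)
  show disj: "P \<inter> translate m ` Q = {}"
  proof (rule ccontr)
    assume "P \<inter> translate m ` Q \<noteq> {}"
    then obtain q where "translate m q \<in> P" "q \<in> Q" by blast
    then show False using P1[of "translate m q"] Q1[of q] T by simp
  qed
  have "P \<union> translate m ` Q \<subseteq> K_bip (m + n)"
  proof
    fix p assume "p \<in> P \<union> translate m ` Q"
    then have "fst p \<in> {1..m + n} \<and> snd p \<in> {1..m + n}"
    proof (elim UnE imageE)
      assume "p \<in> P"
      then show ?thesis using P1[of p] by simp
    next
      fix q assume "p = translate m q" "q \<in> Q"
      then show ?thesis using Q1[of q] T[of q] by simp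
    qed
    then show "p \<in> K_bip (m + n)" by (cases p) (simp add: K_bip_def)
  qed
  moreover have "fst p < fst q \<longleftrightarrow> snd p < snd q"
    if "p \<in> P \<union> translate m ` Q" "q \<in> P \<union> translate m ` Q" for p q
    using that
  proof (elim UnE imageE)
    assume "p \<in> P" "q \<in> P" then show ?thesis using P'(2) by blast
  next
    fix q' assume "p \<in> P" "q = translate m q'" "q' \<in> Q"
    then show ?thesis using P1[of p] Q1[of q'] T by auto
  next
    fix p' assume "q \<in> P" "p = translate m p'" "p' \<in> Q"
    then show ?thesis using P1[of q] Q1[of p'] T by auto
  next
    fix p' q' assume "q = translate m q'" "q' \<in> Q" "p = translate m p'" "p' \<in> Q"
    then show ?thesis using Q'(2) T by simp
  qed
  moreover have "card (P \<union> translate m ` Q) = card P + card Q"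
    using disj P Q by (simp add: card_Un_disjoint card_image[OF inj_translate] finite_planar)
  ultimately show "P \<union> translate m ` Q \<in> feasible (m + n) (r + s)"
    using P Q by (simp add: feasible_def planar_matching_iff)
qed

text \<open>The size requirements \<open>r\<close> and \<open>s\<close> are independent of each
  other: equal densities yield subadditivity, different densities yield convexity of the
  limit.\<close>

lemma min_weight_concat:
  assumes "r \<le> real m" "s \<le> real n"
  shows "min_weight w (m + n) (r + s) \<omega> \<le>
    min_weight w m r \<omega> + min_weight (\<lambda>f. w (translate m f)) n s \<omega>"
proof -
  obtain P where P: "P \<in> feasible m r" "min_weight w m r \<omega> = (\<Sum>f\<in>P. w f \<omega>)"
    using min_weight_attained[OF assms(1)] .
  obtain Q where Q: "Q \<in> feasible n s"
    "min_weight (\<lambda>f. w (translate m f)) n s \<omega> = (\<Sum>f\<in>Q. w (translate m f) \<omega>)"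
    using min_weight_attained[OF assms(2)] .
  have "min_weight w (m + n) (r + s) \<omega> \<le> (\<Sum>f\<in>P \<union> translate m ` Q. w f \<omega>)"
    by (intro min_weight_le feasible_concat P Q)
  also have "\<dots> = (\<Sum>f\<in>P. w f \<omega>) + (\<Sum>f\<in>translate m ` Q. w f \<omega>)"
    using P Q feasible_concat(2) by (intro sum.union_disjoint) auto
  also have "(\<Sum>f\<in>translate m ` Q. w f \<omega>) = (\<Sum>f\<in>Q. w (translate m f) \<omega>)"
    by (simp add: sum.reindex[OF inj_translate])
  finally show ?thesis using P Q by simp
qed

section \<open>Number of planar matchings\<close>

lemma card_less_inj:
  fixes B :: "nat set"
  assumes "finite B" "y \<in> B" "y' \<in> B" "card {b\<in>B. b < y} = card {b\<in>B. b < y'}"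
  shows "y = y'"
proof -
  have False if "y \<in> B" "y < y'" "card {b\<in>B. b < y} = card {b\<in>B. b < y'}" for y y'
  proof -
    have "{b\<in>B. b < y} \<subset> {b\<in>B. b < y'}" using that by auto
    then have "card {b\<in>B. b < y} < card {b\<in>B. b < y'}"
      using \<open>finite B\<close> by (intro psubset_card_mono) simp_all
    then show False using that(3) by simp
  qed
  then show ?thesis using assms by (metis nat_neq_iff)
qed

text \<open>A planar matching pairs vertices of equal rank.\<close>
lemma inj_vertex_sets: "inj_on (\<lambda>P. (fst ` P, snd ` P)) (feasible n r)"
proof -
  have rank: "card {x\<in>fst ` P. x < fst p} = card {y\<in>snd ` P. y < snd p}"
    if "P \<in> feasible n r" "p \<in> P" for P p
  proof -
    have *: "fst a < fst b \<longleftrightarrow> snd a < snd b" if "a \<in> P" "b \<in> P" for a b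
      using \<open>P \<in> feasible n r\<close> that by (simp add: feasible_def planar_matching_iff)
    have inj: "inj_on fst P" "inj_on snd P"
      using * by (intro chain_inj; blast)+
    have "{x\<in>fst ` P. x < fst p} = fst ` {q\<in>P. fst q < fst p}" by auto
    then have "card {x\<in>fst ` P. x < fst p} = card {q\<in>P. fst q < fst p}"
      using inj by (simp add: card_image inj_on_def)
    also have "{q\<in>P. fst q < fst p} = {q\<in>P. snd q < snd p}" using * that by blast
    also have "card \<dots> = card (snd ` {q\<in>P. snd q < snd p})"
      using inj by (simp add: card_image inj_on_def)
    also have "snd ` {q\<in>P. snd q < snd p} = {y\<in>snd ` P. y < snd p}" by auto
    finally show ?thesis .
  qed
  have sub: "P \<subseteq> Q" if P: "P \<in> feasible n r" and Q: "Q \<in> feasible n r"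
    and eq: "fst ` P = fst ` Q" "snd ` P = snd ` Q" for P Q
  proof
    fix p assume "p \<in> P"
    then have "fst p \<in> fst ` Q" unfolding eq(1)[symmetric] by (rule imageI)
    then obtain q where q: "fst p = fst q" "q \<in> Q" by (rule imageE)
    have "snd p \<in> snd ` Q" using \<open>p \<in> P\<close> eq(2) by blast
    then have "snd p = snd q"
      using card_less_inj[of "snd ` Q" "snd p" "snd q"] rank[OF P \<open>p \<in> P\<close>] rank[OF Q q(2)] q eq Q
      by auto
    then show "p \<in> Q" using q by (metis prod_eqI)
  qed
  show ?thesis
  proof (rule inj_onI)
    fix P Q assume "P \<in> feasible n r" "Q \<in> feasible n r" "(fst ` P, snd ` P) = (fst ` Q, snd ` Q)"
    then show "P = Q" using sub[of P Q] sub[of Q P] by simp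
  qed
qed

text \<open>A planar matching is determined by its sets of top and bottom vertices, and there are
  \<open>2 ^ n\<close> choices for each.\<close>

lemma card_feasible: "card (feasible n r) \<le> 4 ^ n"
proof -
  have "card (feasible n r) \<le> card (Pow {1..n} \<times> Pow {1..n})"
  proof (rule card_inj_on_le[OF inj_vertex_sets])
    show "(\<lambda>P. (fst ` P, snd ` P)) ` feasible n r \<subseteq> Pow {1..n} \<times> Pow {1..n}"
      by (fastforce dest: feasible_subset simp: K_bip_def)
  qed simp
  also have "\<dots> = 4 ^ n"
    by (simp add: card_Pow card_cartesian_product flip: power_mult_distrib)
  finally show ?thesis .
qed

section \<open>Independent edge weights\<close>

lemma mult_of_nat_le: "\<rho> \<le> 1 \<Longrightarrow> \<rho> * real n \<le> real n"
  using mult_right_mono[of \<rho> 1 "real n"] by simp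

text \<open>Nonnegativity holds everywhere and not just almost surely, to match
  \<open>subadditive_process\<close>; the final theorem arranges this by truncating the weights at
  0.\<close>

locale iid_weights = prob_space +
  fixes w :: "nat \<times> nat \<Rightarrow> 'a \<Rightarrow> real"
  assumes iid: "iid_family M K_tot w"
    and weight_nonneg: "\<And>f \<omega>. 0 \<le> w f \<omega>"
    and weight_square_integrable: "\<And>f. f \<in> K_tot \<Longrightarrow> integrable M (\<lambda>\<omega>. (w f \<omega>)\<^sup>2)"
    and no_atoms: "\<And>f c. f \<in> K_tot \<Longrightarrow> AE \<omega> in M. w f \<omega> \<noteq> c"
begin

lemma indep: "indep_vars (\<lambda>_. borel) w K_tot"
  and same_distr: "\<And>f g. f \<in> K_tot \<Longrightarrow> g \<in> K_tot \<Longrightarrow> distr M borel (w f) = distr M borel (w g)"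
  using iid unfolding iid_family_def by blast+

lemma weight_measurable [measurable]: "f \<in> K_tot \<Longrightarrow> w f \<in> borel_measurable M"
  using indep by (simp add: indep_vars_def)

lemma integrable_weight: "f \<in> K_tot \<Longrightarrow> integrable M (w f)"
  by (rule square_integrable_imp_integrable[OF _ weight_square_integrable]) simp_all

lemma integral_weight_cong:
  fixes g :: "real \<Rightarrow> real"
  assumes "f \<in> K_tot" "f' \<in> K_tot" and g: "g \<in> borel_measurable borel"
  shows "(\<integral>\<omega>. g (w f \<omega>) \<partial>M) = (\<integral>\<omega>. g (w f' \<omega>) \<partial>M)"
  using integral_distr[OF weight_measurable[OF assms(1)] g] integral_distr[OF weight_measurable[OF assms(2)] g]
  by (simp add: same_distr[OF assms(1,2)])

lemma K_tot_1 [simp]: "(Suc 0, Suc 0) \<in> K_tot"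
  by (simp add: K_tot_def)

lemma translate_K_tot: "f \<in> K_tot \<Longrightarrow> translate m f \<in> K_tot"
  by (auto simp: K_tot_def translate_def)

lemma K_bip_K_tot: "f \<in> K_bip n \<Longrightarrow> f \<in> K_tot"
  by (auto simp: K_tot_def K_bip_def)

section \<open>The blocks as a subadditive process\<close>

definition block :: "real \<Rightarrow> nat \<Rightarrow> nat \<Rightarrow> 'a \<Rightarrow> real" where
  "block \<rho> m n = min_weight (\<lambda>f. w (translate m f)) n (\<rho> * real n)"

lemma block_0: "block \<rho> 0 n = min_weight w n (\<rho> * real n)"
  by (simp add: block_def translate_def)

lemma translate_translate: "translate m (translate n f) = translate (m + n) f"
  by (simp add: translate_def)

lemma block_concat:
  assumes "\<rho> \<le> 1" "\<sigma> \<le> 1"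
  shows "min_weight (\<lambda>f. w (translate m f)) (n + k) (\<rho> * real n + \<sigma> * real k) \<omega>
    \<le> block \<rho> m n \<omega> + block \<sigma> (m + n) k \<omega>"
proof -
  have "\<rho> * real n \<le> n" "\<sigma> * real k \<le> k" using assms by (auto simp: mult_of_nat_le)
  then have "min_weight (\<lambda>f. w (translate m f)) (n + k) (\<rho> * real n + \<sigma> * real k) \<omega>
    \<le> block \<rho> m n \<omega> + min_weight (\<lambda>f. w (translate m (translate n f))) k (\<sigma> * real k) \<omega>"
    unfolding block_def by (rule min_weight_concat)
  then show ?thesis by (simp add: block_def translate_translate)
qed

text \<open>The weights have a product law with equal factors, and translation reindexes it along an
  injection. The resulting law does not depend on \<open>m\<close>, which is the source of
  stationarity.\<close>

lemma distr_translated_weights: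
  "distr M (PiM K_tot (\<lambda>_. borel)) (\<lambda>\<omega>. \<lambda>f\<in>K_tot. w (translate m f) \<omega>)
   = PiM K_tot (\<lambda>_. distr M borel (w (1, 1)))"
proof -
  let ?D = "distr M borel (w (1, 1))"
  let ?B = "PiM K_tot (\<lambda>_. borel) :: (nat \<times> nat \<Rightarrow> real) measure"
  have ne: "K_tot \<noteq> {}" using K_tot_1 by blast
  have sets: "sets (PiM K_tot (\<lambda>_. ?D)) = sets ?B"
    by (intro sets_PiM_cong) simp_all
  have "distr M ?B (\<lambda>\<omega>. \<lambda>f\<in>K_tot. w f \<omega>) = PiM K_tot (\<lambda>f. distr M borel (w f))"
    using indep by (subst (asm) indep_vars_iff_distr_eq_PiM'[OF ne]) auto
  also have "\<dots> = PiM K_tot (\<lambda>_. ?D)"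
    by (intro PiM_cong refl same_distr) auto
  finally have law: "distr M ?B (\<lambda>\<omega>. \<lambda>f\<in>K_tot. w f \<omega>) = PiM K_tot (\<lambda>_. ?D)" .
  have meas: "(\<lambda>x. \<lambda>f\<in>K_tot. x (translate m f)) \<in> measurable ?B ?B"
    by (intro measurable_restrict measurable_component_singleton translate_K_tot)
  have "(\<lambda>\<omega>. \<lambda>f\<in>K_tot. w (translate m f) \<omega>)
      = (\<lambda>x. \<lambda>f\<in>K_tot. x (translate m f)) \<circ> (\<lambda>\<omega>. \<lambda>f\<in>K_tot. w f \<omega>)"
    by (auto simp: fun_eq_iff translate_K_tot restrict_def)
  then have "distr M ?B (\<lambda>\<omega>. \<lambda>f\<in>K_tot. w (translate m f) \<omega>)
      = distr (distr M ?B (\<lambda>\<omega>. \<lambda>f\<in>K_tot. w f \<omega>)) ?B (\<lambda>x. \<lambda>f\<in>K_tot. x (translate m f))"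
    by (subst distr_distr[OF meas]) (auto intro!: measurable_restrict)
  also have "\<dots> = distr (PiM K_tot (\<lambda>_. ?D)) (PiM K_tot (\<lambda>_. ?D)) (\<lambda>x. \<lambda>f\<in>K_tot. x (translate m f))"
    unfolding law by (intro distr_cong refl sets[symmetric])
  also have "\<dots> = PiM K_tot (\<lambda>_. ?D)"
    by (rule distr_PiM_reindex)
       (auto intro!: prob_space_distr inj_translate translate_K_tot)
  finally show ?thesis .
qed

lemma min_weight_coordinates_measurable:
  assumes "\<And>f. f \<in> K_bip n \<Longrightarrow> translate m f \<in> K"
  shows "min_weight (\<lambda>f x. x (translate m f)) n r \<in> borel_measurable (PiM K (\<lambda>_. borel))"
  by (intro min_weight_measurable measurable_component_singleton assms)

text \<open>A row of blocks is one fixed measurable function of the translated weights, so its law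
  does not depend on the starting point. Consecutive diagonal blocks use disjoint sets of edges and
  are therefore independent.\<close>

lemma subadditive_process_block:
  assumes "0 \<le> \<rho>" "\<rho> \<le> 1"
  shows "subadditive_process M (block \<rho>)"
proof
  have le: "\<rho> * real n \<le> real n" for n using assms by (simp add: mult_of_nat_le)
  show meas: "block \<rho> m n \<in> borel_measurable M" for m n
    unfolding block_def
    by (intro min_weight_measurable weight_measurable translate_K_tot) (rule K_bip_K_tot)
  show nn: "0 \<le> block \<rho> m n \<omega>" for m n \<omega>
    unfolding block_def by (intro min_weight_nonneg le weight_nonneg)
  show "block \<rho> m 0 \<omega> = 0" for m \<omega>
  proof -
    have "feasible 0 0 = {{}}" by (auto simp: feasible_def planar_matching_iff K_bip_def)
    then show ?thesis by (simp add: block_def min_weight_eq)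
  qed
  show "block \<rho> m (n + k) \<omega> \<le> block \<rho> m n \<omega> + block \<rho> (m + n) k \<omega>" for m n k \<omega>
    using block_concat[OF assms(2) assms(2), of m n k \<omega>] by (simp add: block_def distrib_left)
  let ?B = "PiM K_tot (\<lambda>_. borel) :: (nat \<times> nat \<Rightarrow> real) measure"
  let ?R = "PiM UNIV (\<lambda>_. borel) :: (nat \<Rightarrow> real) measure"
  \<comment> \<open>The identity \<open>translate 0\<close> is kept so that
    \<open>min_weight_coordinates_measurable\<close> applies literally.\<close>
  define G where "G = (\<lambda>(x :: nat \<times> nat \<Rightarrow> real) n. min_weight (\<lambda>f x. x (translate 0 f)) n (\<rho> * real n) x)"
  have G: "G \<in> measurable ?B ?R"
    unfolding G_def
    by (intro measurable_PiM_single' min_weight_coordinates_measurable translate_K_tot K_bip_K_tot) auto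
  have law: "distr M ?R (\<lambda>\<omega> n. block \<rho> m n \<omega>) = distr (PiM K_tot (\<lambda>_. distr M borel (w (1, 1)))) ?R G" for m
  proof -
    have "(\<lambda>\<omega> n. block \<rho> m n \<omega>) = G \<circ> (\<lambda>\<omega>. \<lambda>f\<in>K_tot. w (translate m f) \<omega>)"
      unfolding G_def block_def fun_eq_iff comp_def
      by (intro allI min_weight_cong) (simp add: K_bip_K_tot translate_def)
    then have "distr M ?R (\<lambda>\<omega> n. block \<rho> m n \<omega>) =
        distr (distr M ?B (\<lambda>\<omega>. \<lambda>f\<in>K_tot. w (translate m f) \<omega>)) ?R G"
      by (subst distr_distr[OF G]) (auto intro!: measurable_restrict weight_measurable translate_K_tot)
    then show ?thesis unfolding distr_translated_weights .
  qed
  show "distr M ?R (\<lambda>\<omega> n. block \<rho> m n \<omega>) = distr M ?R (\<lambda>\<omega> n. block \<rho> 0 n \<omega>)" for m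
    unfolding law ..
  show "indep_vars (\<lambda>_. borel) (\<lambda>i. block \<rho> (i * N) N) UNIV" for N
  proof -
    let ?K = "\<lambda>i. translate (i * N) ` K_bip N"
    have disj: "disjoint_family_on ?K UNIV"
      unfolding disjoint_family_on_def
    proof (intro ballI impI)
      fix i j :: nat assume "i \<noteq> j"
      have False if "i < j" "x \<in> {1..N}" "y \<in> {1..N}" "x + i * N = y + j * N" for i j x y :: nat
      proof -
        have "Suc i * N \<le> j * N" using that(1) by (intro mult_le_mono1) simp
        then show False using that by simp
      qed
      then have "x + i * N \<noteq> y + j * N" if "x \<in> {1..N}" "y \<in> {1..N}" for x y
        using \<open>i \<noteq> j\<close> that nat_neq_iff[of i j] by metis
      then show "?K i \<inter> ?K j = {}"
        by (auto simp: K_bip_def translate_def)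
    qed
    have "indep_vars (\<lambda>i. PiM (?K i) (\<lambda>_. borel)) (\<lambda>i \<omega>. restrict (\<lambda>f. w f \<omega>) (?K i)) UNIV"
      by (rule indep_vars_restrict[OF indep _ disj]) (use translate_K_tot K_bip_K_tot in blast)
    then have "indep_vars (\<lambda>_. borel) (\<lambda>i \<omega>. min_weight (\<lambda>f x. x (translate (i * N) f)) N (\<rho> * real N)
        (restrict (\<lambda>f. w f \<omega>) (?K i))) UNIV"
      by (rule indep_vars_compose2) (rule min_weight_coordinates_measurable, simp)
    also have "(\<lambda>i \<omega>. min_weight (\<lambda>f x. x (translate (i * N) f)) N (\<rho> * real N)
        (restrict (\<lambda>f. w f \<omega>) (?K i))) = (\<lambda>i. block \<rho> (i * N) N)"
      unfolding block_def fun_eq_iff by (intro allI min_weight_cong) simp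
    finally show ?thesis .
  qed
  show "integrable M (\<lambda>\<omega>. (block \<rho> 0 1 \<omega>)\<^sup>2)"
  proof (rule Bochner_Integration.integrable_bound[OF weight_square_integrable[of "(1, 1)"]])
    have "(block \<rho> 0 1 \<omega>)\<^sup>2 \<le> (w (1, 1) \<omega>)\<^sup>2" for \<omega>
    proof (rule power_mono[OF _ nn])
      show "block \<rho> 0 1 \<omega> \<le> w (1, 1) \<omega>"
        using min_weight_le[OF diagonal_feasible[OF le[of 1]], of w \<omega>] by (simp add: block_0)
    qed
    then show "AE \<omega> in M. norm ((block \<rho> 0 1 \<omega>)\<^sup>2) \<le> norm ((w (1, 1) \<omega>)\<^sup>2)" by simp
  qed (use meas in auto)
qed

section \<open>The limit function\<close>

definition \<theta> :: "real \<Rightarrow> real" where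
  "\<theta> \<rho> = subadditive_process.\<theta> M (block \<rho>)"

definition mean :: "real \<Rightarrow> nat \<Rightarrow> real" where
  "mean \<rho> n = (\<integral>\<omega>. min_weight w n (\<rho> * real n) \<omega> \<partial>M)"

context
  fixes \<rho> :: real
  assumes \<rho>: "0 \<le> \<rho>" "\<rho> \<le> 1"
begin

interpretation process: subadditive_process M "block \<rho>"
  using \<rho> by (rule subadditive_process_block)

lemma mean_eq: "mean \<rho> n = process.mean n"
  by (simp add: mean_def process.mean_def block_0)

lemma mean_tendsto: "(\<lambda>n. mean \<rho> n / n) \<longlonglongrightarrow> \<theta> \<rho>"
  using process.mean_tendsto by (simp add: mean_eq \<theta>_def)

lemma \<theta>_le_mean: "n \<ge> 1 \<Longrightarrow> \<theta> \<rho> \<le> mean \<rho> n / n"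
  using process.\<theta>_le by (simp add: mean_eq \<theta>_def)

lemma mean_0: "mean \<rho> 0 = 0"
  by (simp add: mean_eq process.mean_zero)

lemma integrable_block: "integrable M (block \<rho> m n)"
  by (rule process.integrable_a)

lemma integral_block: "(\<integral>\<omega>. block \<rho> m n \<omega> \<partial>M) = mean \<rho> n"
  by (simp add: process.integral_a mean_eq)

lemma min_weight_L2: "(\<lambda>n. \<integral>\<omega>. (min_weight w n (\<rho> * real n) \<omega> / n - \<theta> \<rho>)\<^sup>2 \<partial>M) \<longlonglongrightarrow> 0"
  using process.L2_convergence by (simp add: block_0 \<theta>_def)

lemma min_weight_AE: "AE \<omega> in M. (\<lambda>n. min_weight w n (\<rho> * real n) \<omega> / n) \<longlonglongrightarrow> \<theta> \<rho>"
  using process.AE_convergence by (simp add: block_0 \<theta>_def)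

lemma min_weight_square_integrable: "integrable M (\<lambda>\<omega>. (min_weight w n (\<rho> * real n) \<omega>)\<^sup>2)"
  using process.square_integrable_a[of 0 n] by (simp add: block_0)

end

lemma integrable_min_weight:
  "0 \<le> \<rho> \<Longrightarrow> \<rho> \<le> 1 \<Longrightarrow> integrable M (min_weight w n (\<rho> * real n))"
  using integrable_block[of \<rho> 0 n] by (simp add: block_0)

section \<open>Monotonicity and convexity of the limit\<close>

lemma \<theta>_mono: "mono_on {0..1} \<theta>"
proof (rule mono_onI)
  fix \<rho> \<sigma> :: real assume *: "\<rho> \<in> {0..1}" "\<sigma> \<in> {0..1}" "\<rho> \<le> \<sigma>"
  show "\<theta> \<rho> \<le> \<theta> \<sigma>"
  proof (rule LIMSEQ_le[OF mean_tendsto mean_tendsto])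
    have "mean \<rho> n \<le> mean \<sigma> n" for n
      unfolding mean_def using *
      by (intro integral_mono integrable_min_weight min_weight_mono mult_right_mono)
         (auto simp: mult_of_nat_le)
    then show "\<exists>N. \<forall>n\<ge>N. mean \<rho> n / n \<le> mean \<sigma> n / n" by (intro exI allI impI divide_right_mono) auto
  qed (use * in auto)
qed

text \<open>The hypothesis on \<open>\<tau>\<close> is an inequality to leave room for rounding the
  cut position in \<open>\<theta>_convex\<close>.\<close>

lemma mean_concat:
  fixes \<rho> \<sigma> \<tau> :: real and n k :: nat
  assumes "\<rho> \<in> {0..1}" "\<sigma> \<in> {0..1}" "\<tau> \<in> {0..1}" "\<tau> * real (n + k) \<le> \<rho> * n + \<sigma> * k"
  shows "mean \<tau> (n + k) \<le> mean \<rho> n + mean \<sigma> k"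
proof -
  have le: "\<rho> * n \<le> n" "\<sigma> * k \<le> k" using assms by (auto simp: mult_of_nat_le)
  have "mean \<tau> (n + k) \<le> (\<integral>\<omega>. block \<rho> 0 n \<omega> + block \<sigma> (0 + n) k \<omega> \<partial>M)"
    unfolding mean_def
  proof (rule integral_mono)
    fix \<omega>
    have "min_weight w (n + k) (\<tau> * real (n + k)) \<omega> \<le> min_weight w (n + k) (\<rho> * n + \<sigma> * k) \<omega>"
      using assms le by (intro min_weight_mono) auto
    also have "\<dots> \<le> block \<rho> 0 n \<omega> + block \<sigma> (0 + n) k \<omega>"
      using block_concat[of \<rho> \<sigma> 0 n k \<omega>] assms by (simp add: translate_def)
    finally show "min_weight w (n + k) (\<tau> * real (n + k)) \<omega> \<le> block \<rho> 0 n \<omega> + block \<sigma> (0 + n) k \<omega>" .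
  qed (use assms integrable_min_weight[of \<tau> "n + k"] integrable_block in auto)
  also have "\<dots> = mean \<rho> n + mean \<sigma> k"
    using assms by (simp add: integral_block integrable_block)
  finally show ?thesis .
qed

text \<open>Cut a square of size \<open>N\<close> at the fraction \<open>1 - t\<close>, use density
  \<open>x\<close> on the first part and \<open>y\<close> on the second, and pass to the limit in
  \<open>mean_concat\<close>.\<close>

lemma \<theta>_convex: "convex_on {0..1} \<theta>"
proof (rule convex_on_linorderI)
  fix t x y :: real
  assume t: "0 < t" "t < 1" and xy: "x \<in> {0..1}" "y \<in> {0..1}" "x < y"
  define \<tau> where "\<tau> = (1 - t) * x + t * y"
  have \<tau>: "\<tau> \<in> {0..1}"
  proof -
    have "(1 - t) * x + t * y \<le> (1 - t) * 1 + t * 1" using t xy by (intro add_mono mult_left_mono) auto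
    then show ?thesis using t xy by (auto simp: \<tau>_def)
  qed
  \<comment> \<open>Rounding up favours the denser part, since \<open>x < y\<close>, so the
    concatenation still reaches density \<open>\<tau>\<close>.\<close>
  define k where "k N = nat \<lceil>t * real N\<rceil>" for N
  have k: "t * N \<le> k N" "k N \<le> t * N + 1" "k N \<le> N" for N
  proof -
    have "t * N \<le> 1 * real N" using t by (intro mult_right_mono) auto
    moreover have "0 \<le> t * N" using t by simp
    ultimately show "t * N \<le> k N" "k N \<le> t * N + 1" "k N \<le> N" unfolding k_def by linarith+
  qed
  have bound: "\<theta> \<tau> \<le> mean x (N - k N) / (N - k N) * ((N - k N) / N) + mean y (k N) / k N * (k N / N)"
    if "N \<ge> 1" for N
  proof -
    have "(y - x) * (t * N) \<le> (y - x) * k N" using k(1)[of N] xy by (intro mult_left_mono) auto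
    then have "\<tau> * real ((N - k N) + k N) \<le> x * real (N - k N) + y * k N"
      using k(3)[of N] by (simp add: \<tau>_def of_nat_diff algebra_simps)
    then have "mean \<tau> ((N - k N) + k N) \<le> mean x (N - k N) + mean y (k N)"
      using \<tau> xy by (intro mean_concat) auto
    moreover have "\<theta> \<tau> \<le> mean \<tau> N / N" using \<tau> that by (intro \<theta>_le_mean) auto
    ultimately have "\<theta> \<tau> \<le> (mean x (N - k N) + mean y (k N)) / N"
      using k(3)[of N] that by (auto simp: field_simps)
    \<comment> \<open>If a part is empty, its mean is 0, so the identity survives division by
      zero.\<close>
    moreover have "mean x (N - k N) / N = mean x (N - k N) / real (N - k N) * (real (N - k N) / N)"
      using xy by (cases "N - k N = 0") (auto simp: mean_0)
    moreover have "mean y (k N) / N = mean y (k N) / k N * (k N / N)"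
      using xy by (cases "k N = 0") (auto simp: mean_0)
    ultimately show ?thesis using k(3)[of N] by (simp add: add_divide_distrib)
  qed
  have k_lim: "(\<lambda>N. k N / real N) \<longlonglongrightarrow> t"
  proof (rule tendsto_sandwich)
    show "\<forall>\<^sub>F N in sequentially. t \<le> k N / real N"
      using eventually_ge_at_top[of 1] by eventually_elim (use k in \<open>auto simp: field_simps\<close>)
    show "\<forall>\<^sub>F N in sequentially. k N / real N \<le> t + 1 / real N"
      using eventually_ge_at_top[of 1] by eventually_elim (use k in \<open>auto simp: field_simps\<close>)
    show "(\<lambda>N. t + 1 / real N) \<longlonglongrightarrow> t"
      using tendsto_add[OF tendsto_const lim_const_over_n[of 1]] by simp
  qed simp
  have nk_lim: "(\<lambda>N. (real N - k N) / real N) \<longlonglongrightarrow> 1 - t"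
  proof (rule Lim_transform_eventually)
    show "(\<lambda>N. 1 - k N / real N) \<longlonglongrightarrow> 1 - t" by (intro tendsto_intros k_lim)
    show "\<forall>\<^sub>F N in sequentially. 1 - k N / real N = (real N - k N) / real N"
      using eventually_ge_at_top[of 1] by eventually_elim (simp add: field_simps)
  qed
  have k_top: "filterlim k at_top sequentially"
  proof (rule filterlim_at_top_mono)
    show "filterlim (\<lambda>N. nat \<lfloor>t * real N\<rfloor>) at_top sequentially"
      using t by (intro filterlim_compose[OF filterlim_nat_sequentially]
          filterlim_compose[OF filterlim_floor_sequentially]
          filterlim_tendsto_pos_mult_at_top[OF tendsto_const] filterlim_real_sequentially) auto
    show "\<forall>\<^sub>F N in sequentially. nat \<lfloor>t * real N\<rfloor> \<le> k N"
      unfolding k_def by (intro always_eventually allI nat_mono) linarith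
  qed
  have nk_top: "filterlim (\<lambda>N. N - k N) at_top sequentially"
  proof (rule filterlim_at_top_mono)
    show "filterlim (\<lambda>N. nat \<lfloor>(1 - t) * real N\<rfloor>) at_top sequentially"
      using t by (intro filterlim_compose[OF filterlim_nat_sequentially]
          filterlim_compose[OF filterlim_floor_sequentially]
          filterlim_tendsto_pos_mult_at_top[OF tendsto_const] filterlim_real_sequentially) auto
    show "\<forall>\<^sub>F N in sequentially. nat \<lfloor>(1 - t) * real N\<rfloor> \<le> N - k N"
    proof (intro always_eventually allI)
      fix N
      have "\<lfloor>(1 - t) * real N\<rfloor> \<le> int N - \<lceil>t * real N\<rceil>"
        by (simp add: algebra_simps ceiling_def) linarith
      moreover have "0 \<le> t * real N" using t by simp
      ultimately show "nat \<lfloor>(1 - t) * real N\<rfloor> \<le> N - k N" unfolding k_def by linarith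
    qed
  qed
  have "\<theta> \<tau> \<le> \<theta> x * (1 - t) + \<theta> y * t"
  proof (rule LIMSEQ_le_const)
    have "(\<lambda>N. mean x (N - k N) / real (N - k N)) \<longlonglongrightarrow> \<theta> x"
      using filterlim_compose[OF mean_tendsto[of x] nk_top] xy by simp
    moreover have "(\<lambda>N. mean y (k N) / real (k N)) \<longlonglongrightarrow> \<theta> y"
      using filterlim_compose[OF mean_tendsto[of y] k_top] xy by simp
    ultimately show "(\<lambda>N. mean x (N - k N) / real (N - k N) * ((real N - k N) / N)
        + mean y (k N) / k N * (k N / N)) \<longlonglongrightarrow> \<theta> x * (1 - t) + \<theta> y * t"
      by (intro tendsto_intros nk_lim k_lim)
    show "\<exists>N0. \<forall>N\<ge>N0. \<theta> \<tau> \<le> mean x (N - k N) / real (N - k N) * ((real N - k N) / N)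
        + mean y (k N) / k N * (k N / N)"
      using bound k(3) by (intro exI[of _ 1]) simp
  qed
  then show "\<theta> ((1 - t) *\<^sub>R x + t *\<^sub>R y) \<le> (1 - t) * \<theta> x + t * \<theta> y"
    by (simp add: \<tau>_def mult.commute)
qed simp

lemma \<theta>_0: "\<theta> 0 = 0"
proof -
  have "min_weight w n 0 \<omega> = 0" for n \<omega>
  proof (rule antisym)
    have "{} \<in> feasible n 0" by (simp add: feasible_def planar_matching_iff)
    from min_weight_le[OF this, of w \<omega>] show "min_weight w n 0 \<omega> \<le> 0" by simp
  qed (simp add: min_weight_nonneg weight_nonneg)
  then have "mean 0 n = 0" for n by (simp add: mean_def)
  then have "(\<lambda>n. mean 0 n / real n) \<longlonglongrightarrow> 0" by simp
  then show ?thesis by (intro LIMSEQ_unique[OF mean_tendsto[of 0]]) simp_all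
qed

section \<open>The strict upper bound\<close>

lemma \<theta>_le_\<mu>:
  assumes "\<rho> \<in> {0..1}"
  shows "\<theta> \<rho> \<le> (\<integral>\<omega>. w (1, 1) \<omega> \<partial>M)"
proof -
  have "mean \<rho> 1 \<le> (\<integral>\<omega>. w (1, 1) \<omega> \<partial>M)"
    unfolding mean_def
  proof (rule integral_mono)
    show "min_weight w 1 (\<rho> * real 1) \<omega> \<le> w (1, 1) \<omega>" for \<omega>
      using assms min_weight_le[OF diagonal_feasible[of "\<rho> * real 1" 1], of w \<omega>] by simp
  qed (use assms integrable_min_weight[of \<rho> 1] integrable_weight in auto)
  then show ?thesis using \<theta>_le_mean[of \<rho> 1] assms by simp
qed

text \<open>Equality would force the two weights to agree almost surely. Independence would then
  make the second moment equal to the squared mean, so the weight would be constant, against the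
  absence of atoms.\<close>

lemma expectation_min_less:
  assumes f: "f \<in> K_tot" "g \<in> K_tot" "f \<noteq> g"
  shows "(\<integral>\<omega>. min (w f \<omega>) (w g \<omega>) \<partial>M) < (\<integral>\<omega>. w f \<omega> \<partial>M)"
proof (rule ccontr)
  let ?min = "\<lambda>\<omega>. min (w f \<omega>) (w g \<omega>)"
  let ?\<mu> = "\<integral>\<omega>. w f \<omega> \<partial>M"
  assume "\<not> ?thesis"
  then have ge: "?\<mu> \<le> (\<integral>\<omega>. ?min \<omega> \<partial>M)" by simp
  have same: "(\<integral>\<omega>. w g \<omega> \<partial>M) = ?\<mu>"
    using integral_weight_cong[of g f "\<lambda>x. x"] f by simp
  have int: "integrable M (w f)" "integrable M (w g)" "integrable M ?min"
    using f integrable_weight by auto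
  have eq: "AE \<omega> in M. ?min \<omega> = w h \<omega>" if "h = f \<or> h = g" for h
  proof -
    have h: "integrable M (w h)" "(\<integral>\<omega>. w h \<omega> \<partial>M) = ?\<mu>" using that int same by auto
    have nn: "AE \<omega> in M. 0 \<le> w h \<omega> - ?min \<omega>" using that by auto
    have "(\<integral>\<omega>. w h \<omega> - ?min \<omega> \<partial>M) \<le> 0" using ge h int by simp
    moreover have "0 \<le> (\<integral>\<omega>. w h \<omega> - ?min \<omega> \<partial>M)" by (rule integral_nonneg_AE[OF nn])
    ultimately have "AE \<omega> in M. w h \<omega> - ?min \<omega> = 0"
      using integral_nonneg_eq_0_iff_AE[OF _ nn] h int by simp
    then show ?thesis by eventually_elim simp
  qed
  have "AE \<omega> in M. w f \<omega> = w g \<omega>"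
    using eq[of f, simplified] eq[of g, simplified] by eventually_elim simp
  then have "(\<integral>\<omega>. (w f \<omega>)\<^sup>2 \<partial>M) = (\<integral>\<omega>. w f \<omega> * w g \<omega> \<partial>M)"
    using f by (intro integral_cong_AE) (auto simp: power2_eq_square)
  also have "\<dots> = ?\<mu> * ?\<mu>"
  proof -
    have "(\<integral>\<omega>. (\<Prod>h\<in>{f, g}. w h \<omega>) \<partial>M) = (\<Prod>h\<in>{f, g}. \<integral>\<omega>. w h \<omega> \<partial>M)"
      by (rule indep_vars_lebesgue_integral[OF _ indep_vars_subset[OF indep]]) (use f int in auto)
    then show ?thesis using f same by simp
  qed
  finally have sq: "(\<integral>\<omega>. (w f \<omega>)\<^sup>2 \<partial>M) = ?\<mu> * ?\<mu>" .
  have expand: "(\<lambda>\<omega>. (w f \<omega> - ?\<mu>)\<^sup>2) = (\<lambda>\<omega>. (w f \<omega>)\<^sup>2 - 2 * ?\<mu> * w f \<omega> + ?\<mu> * ?\<mu>)"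
    by (auto simp: power2_eq_square algebra_simps)
  have intv: "integrable M (\<lambda>\<omega>. (w f \<omega> - ?\<mu>)\<^sup>2)"
    unfolding expand using weight_square_integrable[of f] int f by simp
  have "(\<integral>\<omega>. (w f \<omega> - ?\<mu>)\<^sup>2 \<partial>M) = 0"
    unfolding expand using weight_square_integrable[of f] int f by (simp add: sq prob_space)
  then have "AE \<omega> in M. (w f \<omega> - ?\<mu>)\<^sup>2 = 0"
    using integral_nonneg_eq_0_iff_AE[OF intv] by simp
  moreover have "AE \<omega> in M. w f \<omega> \<noteq> ?\<mu>" using f by (intro no_atoms)
  ultimately have "AE \<omega> in M. False" by eventually_elim simp
  then show False by simp
qed

text \<open>The infimum defining \<open>\<theta>\<close> is tested at \<open>n = 2\<close>, where
  one edge suffices and either diagonal edge may serve.\<close>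

lemma \<theta>_half_less: "\<theta> (1/2) < (\<integral>\<omega>. w (1, 1) \<omega> \<partial>M) / 2"
proof -
  have K2: "(2, 2) \<in> K_tot" by (simp add: K_tot_def)
  have "mean (1/2) 2 \<le> (\<integral>\<omega>. min (w (1, 1) \<omega>) (w (2, 2) \<omega>) \<partial>M)"
    unfolding mean_def
  proof (rule integral_mono)
    fix \<omega>
    have "{(1, 1)} \<in> feasible 2 1" "{(2, 2)} \<in> feasible 2 1"
      by (auto simp: feasible_def planar_matching_iff K_bip_def)
    from this[THEN min_weight_le, of w \<omega>]
    show "min_weight w 2 (1/2 * real 2) \<omega> \<le> min (w (1, 1) \<omega>) (w (2, 2) \<omega>)" by simp
  qed (use integrable_min_weight[of "1/2" 2] integrable_weight K2 in auto)
  also have "\<dots> < (\<integral>\<omega>. w (1, 1) \<omega> \<partial>M)"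
    using K2 by (intro expectation_min_less) auto
  finally show ?thesis using \<theta>_le_mean[of "1/2" 2] by simp
qed

text \<open>Up to \<open>1/2\<close>, interpolate between \<open>\<theta> 0 = 0\<close> and the
  strict inequality at \<open>1/2\<close>; beyond it, between that inequality and the weak bound at
  1.\<close>

lemma \<theta>_less:
  assumes "0 < \<rho>" "\<rho> < 1"
  shows "\<theta> \<rho> < (\<integral>\<omega>. w (1, 1) \<omega> \<partial>M) * \<rho>"
proof (cases "\<rho> \<le> 1/2")
  case True
  have "\<theta> ((1 - 2 * \<rho>) *\<^sub>R 0 + (2 * \<rho>) *\<^sub>R (1/2)) \<le> (1 - 2 * \<rho>) * \<theta> 0 + (2 * \<rho>) * \<theta> (1/2)"
    using True assms by (intro convex_onD[OF \<theta>_convex]) auto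
  then have "\<theta> \<rho> \<le> 2 * \<rho> * \<theta> (1/2)" by (simp add: \<theta>_0)
  also have "\<dots> < 2 * \<rho> * ((\<integral>\<omega>. w (1, 1) \<omega> \<partial>M) / 2)"
    using assms by (intro mult_strict_left_mono \<theta>_half_less) auto
  finally show ?thesis by (simp add: mult.commute)
next
  case False
  let ?\<mu> = "\<integral>\<omega>. w (1, 1) \<omega> \<partial>M"
  let ?t = "2 * \<rho> - 1"
  have "\<theta> ((1 - ?t) *\<^sub>R (1/2) + ?t *\<^sub>R 1) \<le> (1 - ?t) * \<theta> (1/2) + ?t * \<theta> 1"
    using False assms by (intro convex_onD[OF \<theta>_convex]) auto
  then have "\<theta> \<rho> \<le> (1 - ?t) * \<theta> (1/2) + ?t * \<theta> 1" by (simp add: algebra_simps)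
  also have "\<dots> < (1 - ?t) * (?\<mu> / 2) + ?t * ?\<mu>"
    using assms False \<theta>_le_\<mu>[of 1]
    by (intro add_less_le_mono mult_strict_left_mono mult_left_mono \<theta>_half_less) auto
  also have "\<dots> = ?\<mu> * \<rho>" by (simp add: field_simps)
  finally show ?thesis .
qed

section \<open>Positivity\<close>

text \<open>A weight is almost surely positive, having no atom at 0, so the exponentials vanish
  pointwise; they are dominated by 1.\<close>

lemma laplace_tendsto: "(\<lambda>k. \<integral>\<omega>. exp (- real k * w (1, 1) \<omega>) \<partial>M) \<longlonglongrightarrow> 0"
proof -
  have "(\<lambda>k. \<integral>\<omega>. exp (- real k * w (1, 1) \<omega>) \<partial>M) \<longlonglongrightarrow> (\<integral>\<omega>. 0 \<partial>M)"
  proof (rule integral_dominated_convergence[where w = "\<lambda>_. 1"])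
    have "AE \<omega> in M. w (1, 1) \<omega> \<noteq> 0" by (intro no_atoms) simp
    then show "AE \<omega> in M. (\<lambda>k. exp (- real k * w (1, 1) \<omega>)) \<longlonglongrightarrow> 0"
    proof eventually_elim
      case (elim \<omega>)
      then have "w (1, 1) \<omega> > 0" using weight_nonneg[of "(1, 1)" \<omega>] by simp
      then have "(\<lambda>k. exp (- w (1, 1) \<omega>) ^ k) \<longlonglongrightarrow> 0" by (intro LIMSEQ_power_zero) simp
      then show ?case by (simp add: exp_of_nat_mult[symmetric] mult.commute)
    qed
  qed (auto simp: weight_nonneg)
  then show ?thesis by simp
qed

text \<open>The assumption on the Laplace transform makes each matching with at least
  \<open>\<rho> * n\<close> edges contribute at most \<open>(1/8) ^ n\<close>. Summed over at most
  \<open>4 ^ n\<close> matchings this is \<open>(1/2) ^ n\<close>, which bounds the mean of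
  \<open>exp (- s * M)\<close> for the minimum weight \<open>M\<close>, and Jensen's inequality
  turns it into a lower bound on the mean of \<open>M\<close>.\<close>

lemma mean_lower:
  assumes \<rho>: "\<rho> \<in> {0..1}" and s: "s > 0"
    and \<phi>: "(\<integral>\<omega>. exp (- s * w (1, 1) \<omega>) \<partial>M) \<le> (1/8) powr (1 / \<rho>)" and "\<rho> > 0"
  shows "real n * (ln 2 / s) \<le> mean \<rho> n"
proof -
  define \<phi> where "\<phi> = (\<integral>\<omega>. exp (- s * w (1, 1) \<omega>) \<partial>M)"
  let ?M = "min_weight w n (\<rho> * real n)"
  have \<phi>_nonneg: "\<phi> \<ge> 0" by (simp add: \<phi>_def)
  have le: "\<rho> * real n \<le> real n" using \<rho> by (intro mult_of_nat_le) simp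
  have K: "f \<in> K_tot" if "P \<in> feasible n (\<rho> * n)" "f \<in> P" for f P
    using that feasible_subset K_bip_K_tot by blast
  have factor_int: "integrable M (\<lambda>\<omega>. exp (- s * w f \<omega>))" if "f \<in> K_tot" for f
    using that s weight_nonneg
    by (intro integrable_const_bound[where B = 1]) (auto simp: weight_measurable)
  have factor: "(\<integral>\<omega>. exp (- s * w f \<omega>) \<partial>M) = \<phi>" if "f \<in> K_tot" for f
    unfolding \<phi>_def using that integral_weight_cong[of f "(1, 1)" "\<lambda>x. exp (- s * x)"] by simp
  have prod: "integrable M (\<lambda>\<omega>. \<Prod>f\<in>P. exp (- s * w f \<omega>))"
    "(\<integral>\<omega>. (\<Prod>f\<in>P. exp (- s * w f \<omega>)) \<partial>M) \<le> (1/8) ^ n" if P: "P \<in> feasible n (\<rho> * n)" for P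
  proof -
    have ind: "indep_vars (\<lambda>_. borel) (\<lambda>f \<omega>. exp (- s * w f \<omega>)) P"
      by (rule indep_vars_compose2[OF indep_vars_subset[OF indep]]) (use K P in auto)
    have fin: "finite P" using P by (rule finite_planar)
    show "integrable M (\<lambda>\<omega>. \<Prod>f\<in>P. exp (- s * w f \<omega>))"
      by (rule indep_vars_integrable[OF fin ind]) (use K P factor_int in blast)
    have "(\<integral>\<omega>. (\<Prod>f\<in>P. exp (- s * w f \<omega>)) \<partial>M) = (\<Prod>f\<in>P. \<integral>\<omega>. exp (- s * w f \<omega>) \<partial>M)"
      by (rule indep_vars_lebesgue_integral[OF fin ind]) (use K P factor_int in blast)
    also have "\<dots> = \<phi> ^ card P"
      using factor K[OF P] by (subst prod.cong[OF refl, where h = "\<lambda>_. \<phi>"]) simp_all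
    also have "\<dots> \<le> ((1/8) powr (1 / \<rho>)) ^ card P"
      using \<phi> \<phi>_nonneg by (intro power_mono) (simp_all add: \<phi>_def)
    also have "\<dots> = (1/8) powr (card P / \<rho>)"
      by (simp add: powr_powr flip: powr_realpow)
    also have "\<dots> \<le> (1/8) powr (real n)"
      using P \<open>\<rho> > 0\<close> by (intro powr_mono') (auto simp: feasible_def field_simps)
    also have "\<dots> = (1/8) ^ n" by (simp add: powr_realpow)
    finally show "(\<integral>\<omega>. (\<Prod>f\<in>P. exp (- s * w f \<omega>)) \<partial>M) \<le> (1/8) ^ n" .
  qed
  have intM: "integrable M ?M" using \<rho> by (intro integrable_min_weight) auto
  have pt1: "exp (- s * ?M \<omega>) \<le> (\<Sum>P\<in>feasible n (\<rho> * n). \<Prod>f\<in>P. exp (- s * w f \<omega>))" for \<omega>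
  proof -
    obtain P where P: "P \<in> feasible n (\<rho> * n)" "?M \<omega> = (\<Sum>f\<in>P. w f \<omega>)"
      using min_weight_attained[OF le] .
    have "exp (- s * ?M \<omega>) = (\<Prod>f\<in>P. exp (- s * w f \<omega>))"
      using P(2) finite_planar[OF P(1)] by (simp add: sum_distrib_left exp_sum flip: sum_negf)
    also have "\<dots> \<le> (\<Sum>P\<in>feasible n (\<rho> * n). \<Prod>f\<in>P. exp (- s * w f \<omega>))"
      using P(1) by (intro member_le_sum prod_nonneg) auto
    finally show ?thesis .
  qed
  \<comment> \<open>Jensen's inequality, as the tangent of the exponential at the mean.\<close>
  have pt2: "exp (- s * mean \<rho> n) * (1 - s * (?M \<omega> - mean \<rho> n)) \<le> exp (- s * ?M \<omega>)" for \<omega>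
  proof -
    have "exp (- s * mean \<rho> n) * (1 + (- s * (?M \<omega> - mean \<rho> n)))
        \<le> exp (- s * mean \<rho> n) * exp (- s * (?M \<omega> - mean \<rho> n))"
      by (intro mult_left_mono exp_ge_add_one_self) simp
    also have "\<dots> = exp (- s * ?M \<omega>)" by (simp add: algebra_simps flip: exp_add)
    finally show ?thesis by simp
  qed
  have "exp (- s * mean \<rho> n) = (\<integral>\<omega>. exp (- s * mean \<rho> n) * (1 - s * (?M \<omega> - mean \<rho> n)) \<partial>M)"
    using intM by (simp add: prob_space mean_def)
  also have "\<dots> \<le> (\<integral>\<omega>. (\<Sum>P\<in>feasible n (\<rho> * n). \<Prod>f\<in>P. exp (- s * w f \<omega>)) \<partial>M)"
    using intM prod(1) by (intro integral_mono order_trans[OF pt2 pt1]) auto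
  also have "\<dots> = (\<Sum>P\<in>feasible n (\<rho> * n). \<integral>\<omega>. (\<Prod>f\<in>P. exp (- s * w f \<omega>)) \<partial>M)"
    using prod(1) by (rule Bochner_Integration.integral_sum)
  also have "\<dots> \<le> (\<Sum>P\<in>feasible n (\<rho> * n). (1/8) ^ n)"
    by (intro sum_mono prod)
  also have "\<dots> = real (card (feasible n (\<rho> * n))) * (1/8) ^ n" by simp
  also have "\<dots> \<le> 4 ^ n * (1/8) ^ n"
    using card_feasible[of n "\<rho> * n"] by (intro mult_right_mono) (simp_all flip: of_nat_le_iff)
  also have "\<dots> = (1/2) ^ n" by (simp flip: power_mult_distrib)
  also have "\<dots> = exp (- (real n * ln 2))"
    by (simp add: exp_minus exp_of_nat_mult power_one_over inverse_eq_divide)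
  finally have "real n * ln 2 \<le> s * mean \<rho> n" by simp
  then show ?thesis using s by (simp add: field_simps)
qed

text \<open>The parameter \<open>k\<close> depends on \<open>\<rho>\<close> only, so the bound of
  \<open>mean_lower\<close> is linear in \<open>n\<close> and survives in the limit.\<close>

lemma \<theta>_pos:
  assumes "0 < \<rho>" "\<rho> \<le> 1"
  shows "0 < \<theta> \<rho>"
proof -
  have "\<forall>\<^sub>F k in sequentially. (\<integral>\<omega>. exp (- real k * w (1, 1) \<omega>) \<partial>M) < (1/8) powr (1 / \<rho>)"
    by (rule order_tendstoD(2)[OF laplace_tendsto]) simp
  then have "\<forall>\<^sub>F k in sequentially. k \<ge> 1 \<and> (\<integral>\<omega>. exp (- real k * w (1, 1) \<omega>) \<partial>M) < (1/8) powr (1 / \<rho>)"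
    by (intro eventually_conj eventually_ge_at_top)
  then obtain k where k: "k \<ge> 1" "(\<integral>\<omega>. exp (- real k * w (1, 1) \<omega>) \<partial>M) \<le> (1/8) powr (1 / \<rho>)"
    using eventually_happens'[OF sequentially_bot] by (metis (no_types, lifting) less_imp_le)
  have "ln 2 / k \<le> \<theta> \<rho>"
  proof (rule LIMSEQ_le_const[OF mean_tendsto])
    have "ln 2 / k \<le> mean \<rho> n / n" if "n \<ge> 1" for n
      using mean_lower[of \<rho> "real k" n] k assms that by (simp add: field_simps)
    then show "\<exists>N. \<forall>n\<ge>N. ln 2 / k \<le> mean \<rho> n / n" by blast
  qed (use assms in auto)
  moreover have "0 < ln 2 / real k" using k by simp
  ultimately show ?thesis by linarith
qed

end

section \<open>The limit theorem\<close>

text \<open>Chebyshev's inequality, carried out with extended integrals as in the definition of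
  convergence in mean square.\<close>

lemma converges_in_probability_if_L2:
  assumes "prob_space M" and L2: "converges_in_L2 M X c"
  shows "converges_in_probability M X c"
  unfolding converges_in_probability_def
proof (intro conjI allI impI)
  interpret prob_space M by fact
  show meas: "X n \<in> borel_measurable M" for n using L2 by (simp add: converges_in_L2_def)
  fix \<epsilon> :: real assume "\<epsilon> > 0"
  let ?I = "\<lambda>n. \<integral>\<^sup>+\<omega>. ennreal ((X n \<omega> - c)\<^sup>2) \<partial>M"
  have bound: "ennreal (measure M {\<omega> \<in> space M. \<bar>X n \<omega> - c\<bar> > \<epsilon>}) \<le> ennreal (1 / \<epsilon>\<^sup>2) * ?I n" for n
  proof -
    have [measurable]: "X n \<in> borel_measurable M" by (rule meas)
    have "emeasure M {\<omega> \<in> space M. \<bar>X n \<omega> - c\<bar> > \<epsilon>} = (\<integral>\<^sup>+\<omega>. indicator {\<omega> \<in> space M. \<bar>X n \<omega> - c\<bar> > \<epsilon>} \<omega> \<partial>M)"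
      by simp
    also have "\<dots> \<le> (\<integral>\<^sup>+\<omega>. ennreal (1 / \<epsilon>\<^sup>2) * ennreal ((X n \<omega> - c)\<^sup>2) \<partial>M)"
    proof (intro nn_integral_mono)
      fix \<omega> assume "\<omega> \<in> space M"
      show "indicator {\<omega> \<in> space M. \<bar>X n \<omega> - c\<bar> > \<epsilon>} \<omega> \<le> ennreal (1 / \<epsilon>\<^sup>2) * ennreal ((X n \<omega> - c)\<^sup>2)"
      proof (cases "\<bar>X n \<omega> - c\<bar> > \<epsilon>")
        case True
        then have "\<epsilon>\<^sup>2 \<le> (X n \<omega> - c)\<^sup>2" using \<open>\<epsilon> > 0\<close> by (simp add: abs_le_square_iff[symmetric])
        then have "1 \<le> 1 / \<epsilon>\<^sup>2 * (X n \<omega> - c)\<^sup>2" using \<open>\<epsilon> > 0\<close> by (simp add: field_simps)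
        have "indicator {\<omega> \<in> space M. \<bar>X n \<omega> - c\<bar> > \<epsilon>} \<omega> \<le> (1 :: ennreal)"
          by (simp add: indicator_def)
        also have "1 \<le> ennreal (1 / \<epsilon>\<^sup>2 * (X n \<omega> - c)\<^sup>2)"
          using \<open>1 \<le> 1 / \<epsilon>\<^sup>2 * (X n \<omega> - c)\<^sup>2\<close> by simp
        also have "\<dots> = ennreal (1 / \<epsilon>\<^sup>2) * ennreal ((X n \<omega> - c)\<^sup>2)" by (rule ennreal_mult) simp_all
        finally show ?thesis .
      qed simp
    qed
    also have "\<dots> = ennreal (1 / \<epsilon>\<^sup>2) * ?I n" by (rule nn_integral_cmult) simp
    finally show ?thesis by (simp add: emeasure_eq_measure)
  qed
  have "(\<lambda>n. ennreal (1 / \<epsilon>\<^sup>2) * ?I n) \<longlonglongrightarrow> ennreal (1 / \<epsilon>\<^sup>2) * 0"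
    using L2 by (intro ennreal_tendsto_cmult) (simp_all add: converges_in_L2_def)
  then have "(\<lambda>n. ennreal (1 / \<epsilon>\<^sup>2) * ?I n) \<longlonglongrightarrow> 0" by simp
  then have "(\<lambda>n. ennreal (measure M {\<omega> \<in> space M. \<bar>X n \<omega> - c\<bar> > \<epsilon>})) \<longlonglongrightarrow> 0"
    by (rule tendsto_sandwich[OF _ _ tendsto_const, rotated 2]) (use bound in auto)
  then show "(\<lambda>n. measure M {\<omega> \<in> space M. \<bar>X n \<omega> - c\<bar> > \<epsilon>}) \<longlonglongrightarrow> 0"
    by (simp add: tendsto_ennreal_iff flip: ennreal_0)
qed

text \<open>The distribution function is continuous at \<open>c\<close> exactly when the law gives
  \<open>{c}\<close> no mass.\<close>

lemma AE_neq_if_continuous_distribution: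
  assumes "prob_space M" and [measurable]: "X \<in> borel_measurable M" and "continuous_distribution M X"
  shows "AE \<omega> in M. X \<omega> \<noteq> c"
proof -
  interpret prob_space M by fact
  interpret D: real_distribution "distr M borel X"
    by (rule real_distribution_distr) simp
  have "isCont (cdf (distr M borel X)) c"
    using assms(3) by (simp add: continuous_distribution_def continuous_on_eq_continuous_at)
  then have "measure (distr M borel X) {c} = 0" by (simp add: D.isCont_cdf)
  then have "emeasure M {\<omega> \<in> space M. X \<omega> = c} = 0"
    by (simp add: measure_distr emeasure_eq_measure vimage_def Int_def conj_commute)
  then show ?thesis by (intro AE_I[where N = "{\<omega> \<in> space M. X \<omega> = c}"]) auto
qed

theorem theorem3:
  fixes M :: "'a measure"
    and w :: "nat \<times> nat \<Rightarrow> 'a \<Rightarrow> real"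
    and \<mu> :: real
  assumes "prob_space M"
    and "iid_family M K_tot w"
    and "\<And>f. f \<in> K_tot \<Longrightarrow> AE \<omega> in M. w f \<omega> \<ge> 0"
    and "\<And>f. f \<in> K_tot \<Longrightarrow> continuous_distribution M (w f)"
    and "\<And>f. f \<in> K_tot \<Longrightarrow> integrable M (\<lambda>\<omega>. (w f \<omega>)^2)"
    and "\<And>f. f \<in> K_tot \<Longrightarrow> \<mu> = (\<integral>\<omega>. w f \<omega> \<partial>M)"
  shows "\<exists>\<theta> :: real \<Rightarrow> real.
    (\<forall>\<rho>\<in>{0..1}.
       converges_in_probability M (\<lambda>n \<omega>. min_weight w n (\<rho> * real n) \<omega> / real n) (\<theta> \<rho>) \<and>
       converges_in_L2 M (\<lambda>n \<omega>. min_weight w n (\<rho> * real n) \<omega> / real n) (\<theta> \<rho>)) \<and>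
    mono_on {0..1} \<theta> \<and> convex_on {0..1} \<theta> \<and> \<theta> 0 = 0 \<and>
    (\<forall>\<rho>. 0 < \<rho> \<and> \<rho> < 1 \<longrightarrow> 0 < \<theta> \<rho> \<and> \<theta> \<rho> < \<mu> * \<rho>) \<and>
    ((\<forall>f\<in>K_tot. integrable M (\<lambda>\<omega>. (w f \<omega>)^4)) \<longrightarrow>
       (\<forall>\<rho>\<in>{0..1}. AE \<omega> in M.
          (\<lambda>n. min_weight w n (\<rho> * real n) \<omega> / real n) \<longlonglongrightarrow> \<theta> \<rho>))"
proof -
  interpret prob_space M by fact
  have ind: "indep_vars (\<lambda>_. borel) w K_tot"
    and same: "\<And>f g. f \<in> K_tot \<Longrightarrow> g \<in> K_tot \<Longrightarrow> distr M borel (w f) = distr M borel (w g)"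
    using assms(2) unfolding iid_family_def by blast+
  have meas: "w f \<in> borel_measurable M" if "f \<in> K_tot" for f
    using ind that by (simp add: indep_vars_def)
  \<comment> \<open>Truncation makes the weights nonnegative everywhere and changes each only on a
    null set, so the family keeps its law.\<close>
  define v where "v f \<omega> = max 0 (w f \<omega>)" for f \<omega>
  have v_eq: "AE \<omega> in M. v f \<omega> = w f \<omega>" if "f \<in> K_tot" for f
    using assms(3)[OF that] by eventually_elim (simp add: v_def)
  have v_meas: "v f \<in> borel_measurable M" if "f \<in> K_tot" for f
    unfolding v_def[abs_def] using meas[OF that] by measurable
  interpret v: iid_weights M v
  proof
    show "iid_family M K_tot v"
      unfolding iid_family_def
    proof (intro conjI ballI)
      show "indep_vars (\<lambda>_. borel) v K_tot"
        unfolding v_def[abs_def] by (rule indep_vars_compose2[OF ind]) simp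
      fix f g assume f: "f \<in> K_tot" and g: "g \<in> K_tot"
      have "distr M borel (v f) = distr M borel (w f)"
        using v_eq[OF f] v_meas[OF f] meas[OF f] by (intro distr_cong_AE) auto
      also have "\<dots> = distr M borel (w g)" by (rule same[OF f g])
      also have "\<dots> = distr M borel (v g)"
        using v_eq[OF g] v_meas[OF g] meas[OF g] by (intro distr_cong_AE) (auto elim: eventually_mono)
      finally show "distr M borel (v f) = distr M borel (v g)" .
    qed
    show "0 \<le> v f \<omega>" for f \<omega> by (simp add: v_def)
    show "integrable M (\<lambda>\<omega>. (v f \<omega>)\<^sup>2)" if "f \<in> K_tot" for f
    proof (rule Bochner_Integration.integrable_bound[OF assms(5)[OF that]])
      show "(\<lambda>\<omega>. (v f \<omega>)\<^sup>2) \<in> borel_measurable M" using v_meas[OF that] by simp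
    qed (auto simp: v_def max_def)
    show "AE \<omega> in M. v f \<omega> \<noteq> c" if "f \<in> K_tot" for f c
      using v_eq[OF that] AE_neq_if_continuous_distribution[OF assms(1) meas[OF that] assms(4)[OF that], of c]
      by eventually_elim simp
  qed
  have K11: "(1, 1) \<in> K_tot" by simp
  have \<mu>: "\<mu> = (\<integral>\<omega>. v (1, 1) \<omega> \<partial>M)"
    unfolding assms(6)[OF K11]
    using v_eq[OF K11] meas[OF K11] v_meas[OF K11] by (intro integral_cong_AE) (auto elim: eventually_mono)
  \<comment> \<open>There are countably many edges, so one null set covers them all, and off it the
    minimum weights agree for all \<open>n\<close> and \<open>r\<close> simultaneously.\<close>
  have "AE \<omega> in M. \<forall>f\<in>K_tot. v f \<omega> = w f \<omega>"
    by (subst AE_ball_countable) (use v_eq in auto)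
  then have M_eq: "AE \<omega> in M. \<forall>n r. min_weight w n r \<omega> = min_weight v n r \<omega>"
  proof eventually_elim
    case (elim \<omega>)
    show ?case by (intro allI min_weight_cong) (use elim v.K_bip_K_tot in metis)
  qed
  have L2: "converges_in_L2 M (\<lambda>n \<omega>. min_weight w n (\<rho> * real n) \<omega> / real n) (v.\<theta> \<rho>)" if \<rho>: "\<rho> \<in> {0..1}" for \<rho>
    unfolding converges_in_L2_def
  proof
    show "\<forall>n. (\<lambda>\<omega>. min_weight w n (\<rho> * real n) \<omega> / real n) \<in> borel_measurable M"
      by (intro allI borel_measurable_divide min_weight_measurable meas v.K_bip_K_tot) auto
    have "(\<integral>\<^sup>+\<omega>. ennreal ((min_weight w n (\<rho> * real n) \<omega> / real n - v.\<theta> \<rho>)\<^sup>2) \<partial>M)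
        = ennreal (\<integral>\<omega>. (min_weight v n (\<rho> * real n) \<omega> / real n - v.\<theta> \<rho>)\<^sup>2 \<partial>M)" for n
    proof -
      let ?x = "\<lambda>\<omega>. min_weight v n (\<rho> * real n) \<omega>"
      \<comment> \<open>Expanding the square shows integrability, which identifies the extended
        integral with the real one bounded in \<open>min_weight_L2\<close>.\<close>
      have "(\<lambda>\<omega>. (?x \<omega> / real n - v.\<theta> \<rho>)\<^sup>2)
          = (\<lambda>\<omega>. (?x \<omega>)\<^sup>2 / (real n)\<^sup>2 - 2 * v.\<theta> \<rho> * (?x \<omega> / n) + (v.\<theta> \<rho>)\<^sup>2)"
        by (auto simp: power2_eq_square algebra_simps)
      then have int: "integrable M (\<lambda>\<omega>. (?x \<omega> / real n - v.\<theta> \<rho>)\<^sup>2)"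
        using v.min_weight_square_integrable[of \<rho> n] v.integrable_min_weight[of \<rho> n] \<rho> by simp
      have "(\<integral>\<^sup>+\<omega>. ennreal ((min_weight w n (\<rho> * real n) \<omega> / real n - v.\<theta> \<rho>)\<^sup>2) \<partial>M)
          = (\<integral>\<^sup>+\<omega>. ennreal ((?x \<omega> / real n - v.\<theta> \<rho>)\<^sup>2) \<partial>M)"
        using M_eq by (intro nn_integral_cong_AE) (auto elim: eventually_mono)
      also have "\<dots> = ennreal (\<integral>\<omega>. (?x \<omega> / real n - v.\<theta> \<rho>)\<^sup>2 \<partial>M)"
        by (rule nn_integral_eq_integral[OF int]) simp
      finally show ?thesis .
    qed
    moreover have "(\<lambda>n. ennreal (\<integral>\<omega>. (min_weight v n (\<rho> * real n) \<omega> / real n - v.\<theta> \<rho>)\<^sup>2 \<partial>M)) \<longlonglongrightarrow> ennreal 0"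
      using v.min_weight_L2[of \<rho>] \<rho> by (intro tendsto_ennrealI) auto
    ultimately show "(\<lambda>n. \<integral>\<^sup>+\<omega>. ennreal ((min_weight w n (\<rho> * real n) \<omega> / real n - v.\<theta> \<rho>)\<^sup>2) \<partial>M) \<longlonglongrightarrow> 0"
      by simp
  qed
  have "AE \<omega> in M. (\<lambda>n. min_weight w n (\<rho> * real n) \<omega> / real n) \<longlonglongrightarrow> v.\<theta> \<rho>" if "\<rho> \<in> {0..1}" for \<rho>
  proof -
    have "AE \<omega> in M. (\<lambda>n. min_weight v n (\<rho> * real n) \<omega> / real n) \<longlonglongrightarrow> v.\<theta> \<rho>"
      using that by (intro v.min_weight_AE) auto
    with M_eq show ?thesis by eventually_elim simp
  qed
  then show ?thesis
    using L2 converges_in_probability_if_L2[OF assms(1) L2] v.\<theta>_mono v.\<theta>_convex v.\<theta>_0 v.\<theta>_pos v.\<theta>_less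
    by (intro exI[of _ v.\<theta>]) (simp add: \<mu>)
qed

end
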